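(* Let $n\ge0$. Let $\mathbf\Delta^n$ denote the oriented $n$-simplex ($n$-th oriental) and $\square^n$ the oriented $n$-cube. There are canonical isomorphisms of posets: (1) $\pi_0(\mathbf\Delta^n)\cong[n]=\{0<1<\dots<n\}$; (2) $\pi_1(\mathbf\Delta^n,(i,j))\cong(\mathbb D^1)^{\times(j-i-1)}\cong\{A\subset\{i+1,\dots,j-1\}\}$ for every $0\le i<j\le n$; (3) $\pi_0(\square^n)\cong(\mathbb D^1)^{\times n}$; (4) $\pi_1(\square^n,(\delta,\epsilon))\cong\mathbb S^{|\epsilon-\delta|}$ for every $\delta,\epsilon\in(\mathbb D^1)^{\times n}$.
   Context: For an $\infty$-category $X$ with morphism $\infty$-categories $\mathrm{Mor}_X(A,B)$, $\pi_0(X)$ is the poset of equivalence classes of objects modulo $C\sim D$ iff there are morphisms $C\to D$ and $D\to C$, ordered by $[C]\le[D]$ iff there is a morphism $C\to D$. For objects $A,B$ of $X$, $\pi_1(X,(A,B)):=\pi_0(\mathrm{Mor}_X(A,B))$. $\mathbf\Delta^n$ is Street's $n$-th oriental, a strict $n$-category with objects $0,\dots,n$. $\square^n=(\mathbb D^1)^{\boxtimes n}$ is the $n$-fold Gray tensor power of the walking arrow $\mathbb D^1$, a strict $n$-category with set of objects $\{0,1\}^n$. In the claim $\mathbb D^1$ denotes the poset $\{0<1\}$, $(\mathbb D^1)^{\times n}$ has the product order, and $\{A\subset\{i+1,\dots,j-1\}\}$ is ordered by inclusion. For $\delta,\epsilon\in\{0,1\}^n$ put $|\epsilon-\delta|=-\infty$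 if $\delta_i>\epsilon_i$ for some $i$, and otherwise $|\epsilon-\delta|=\sum_i(\epsilon_i-\delta_i)$. $\mathbb S^m$ is the set of permutations of $\{1<\dots<m\}$ with the (weak Bruhat) partial order generated by $\rho\le\sigma$ whenever $\sigma=\tau_{\rho(i),\rho(i+1)}\circ\rho$ for some $i$ with $\rho(i)<\rho(i+1)$, where $\tau_{a,b}$ is the transposition of $a$ and $b$; $\mathbb S^0$ is a singleton and $\mathbb S^{-\infty}$ is empty. *)

theory Defs
  imports
    Complex_Main
    "HOL-Library.Poly_Mapping"
    "HOL-Combinatorics.Permutations"
begin

section \<open>Strict \<open>\<omega>\<close>-categories\<close>

text \<open>
  The single-sorted presentation: there is one set of cells, a cell of dimension at most \<open>n\<close> is a
  cell fixed by the \<open>n\<close>-dimensional boundary operators, and identities are not distinguished from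
  the cells they are identities of.  \<open>bdry X False n\<close> is the \<open>n\<close>-source and \<open>bdry X True n\<close> the
  \<open>n\<close>-target; \<open>comp X n x y\<close> is meaningful when the \<open>n\<close>-target of \<open>x\<close> is the \<open>n\<close>-source of \<open>y\<close>.
\<close>

record 'c omega_cat =
  cells :: "'c set"
  bdry :: "bool \<Rightarrow> nat \<Rightarrow> 'c \<Rightarrow> 'c"
  comp :: "nat \<Rightarrow> 'c \<Rightarrow> 'c \<Rightarrow> 'c"

locale strict_omega_category =
  fixes X :: "'c omega_cat"
  assumes bdry_closed: "x \<in> cells X \<Longrightarrow> bdry X \<alpha> n x \<in> cells X"
    and finite_dim: "x \<in> cells X \<Longrightarrow> \<exists>n. \<forall>\<alpha>. bdry X \<alpha> n x = x"
    and bdry_bdry_less: "x \<in> cells X \<Longrightarrow> m < n \<Longrightarrow> bdry X \<beta> m (bdry X \<alpha> n x) = bdry X \<beta> m x"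
    and bdry_bdry_ge: "x \<in> cells X \<Longrightarrow> n \<le> m \<Longrightarrow> bdry X \<beta> m (bdry X \<alpha> n x) = bdry X \<alpha> n x"
    and comp_closed: "x \<in> cells X \<Longrightarrow> y \<in> cells X \<Longrightarrow> bdry X True n x = bdry X False n y
          \<Longrightarrow> comp X n x y \<in> cells X"
    and bdry_comp_less: "x \<in> cells X \<Longrightarrow> y \<in> cells X \<Longrightarrow> bdry X True n x = bdry X False n y
          \<Longrightarrow> m < n \<Longrightarrow> bdry X \<alpha> m (comp X n x y) = bdry X \<alpha> m x"
    and source_comp: "x \<in> cells X \<Longrightarrow> y \<in> cells X \<Longrightarrow> bdry X True n x = bdry X False n y
          \<Longrightarrow> bdry X False n (comp X n x y) = bdry X False n x"
    and target_comp: "x \<in> cells X \<Longrightarrow> y \<in> cells X \<Longrightarrow> bdry X True n x = bdry X False n y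
          \<Longrightarrow> bdry X True n (comp X n x y) = bdry X True n y"
    and bdry_comp_greater: "x \<in> cells X \<Longrightarrow> y \<in> cells X \<Longrightarrow> bdry X True n x = bdry X False n y
          \<Longrightarrow> n < m \<Longrightarrow> bdry X \<alpha> m (comp X n x y) = comp X n (bdry X \<alpha> m x) (bdry X \<alpha> m y)"
    and unit_left: "x \<in> cells X \<Longrightarrow> comp X n (bdry X False n x) x = x"
    and unit_right: "x \<in> cells X \<Longrightarrow> comp X n x (bdry X True n x) = x"
    and comp_assoc: "x \<in> cells X \<Longrightarrow> y \<in> cells X \<Longrightarrow> z \<in> cells X
          \<Longrightarrow> bdry X True n x = bdry X False n y \<Longrightarrow> bdry X True n y = bdry X False n z
          \<Longrightarrow> comp X n (comp X n x y) z = comp X n x (comp X n y z)"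
    and interchange: "x \<in> cells X \<Longrightarrow> y \<in> cells X \<Longrightarrow> z \<in> cells X \<Longrightarrow> w \<in> cells X \<Longrightarrow> m < n
          \<Longrightarrow> bdry X True n x = bdry X False n y \<Longrightarrow> bdry X True n z = bdry X False n w
          \<Longrightarrow> bdry X True m x = bdry X False m z
          \<Longrightarrow> comp X m (comp X n x y) (comp X n z w) = comp X n (comp X m x z) (comp X m y w)"

definition strict_n_category :: "nat \<Rightarrow> 'c omega_cat \<Rightarrow> bool" where
  "strict_n_category n X \<longleftrightarrow>
     strict_omega_category X \<and> (\<forall>x\<in>cells X. \<forall>\<alpha>. bdry X \<alpha> n x = x)"

definition objects :: "'c omega_cat \<Rightarrow> 'c set" where
  "objects X = {x \<in> cells X. bdry X False 0 x = x}"

definition Mor :: "'c omega_cat \<Rightarrow> 'c \<Rightarrow> 'c \<Rightarrow> 'c omega_cat" where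
  "Mor X A B = \<lparr> cells = {x \<in> cells X. bdry X False 0 x = A \<and> bdry X True 0 x = B},
                 bdry = (\<lambda>\<alpha> n. bdry X \<alpha> (Suc n)),
                 comp = (\<lambda>n. comp X (Suc n)) \<rparr>"


section \<open>The posets \<open>\<pi>\<^sub>0\<close> and \<open>\<pi>\<^sub>1\<close>\<close>

text \<open>Posets are represented by their order relation; the carrier is the \<^const>\<open>Field\<close>.\<close>

definition poset_iso :: "'a rel \<Rightarrow> 'b rel \<Rightarrow> ('a \<Rightarrow> 'b) \<Rightarrow> bool" where
  "poset_iso r s f \<longleftrightarrow> Partial_order r \<and> Partial_order s \<and> iso r s f"

definition mor_rel :: "'c omega_cat \<Rightarrow> 'c rel" where
  "mor_rel X = {(C, D). C \<in> objects X \<and> D \<in> objects X \<and>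
     (\<exists>f\<in>cells X. bdry X False 1 f = f \<and> bdry X False 0 f = C \<and> bdry X True 0 f = D)}"

definition mor_equiv :: "'c omega_cat \<Rightarrow> 'c rel" where
  "mor_equiv X = mor_rel X \<inter> (mor_rel X)\<inverse>"

definition pi0_class :: "'c omega_cat \<Rightarrow> 'c \<Rightarrow> 'c set" where
  "pi0_class X C = mor_equiv X `` {C}"

definition pi0 :: "'c omega_cat \<Rightarrow> 'c set rel" where
  "pi0 X = {(P, Q). P \<in> objects X // mor_equiv X \<and> Q \<in> objects X // mor_equiv X \<and>
                    (\<exists>C\<in>P. \<exists>D\<in>Q. (C, D) \<in> mor_rel X)}"

definition pi1 :: "'c omega_cat \<Rightarrow> 'c \<Rightarrow> 'c \<Rightarrow> 'c set rel" where
  "pi1 X A B = pi0 (Mor X A B)"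

definition pi1_class :: "'c omega_cat \<Rightarrow> 'c \<Rightarrow> 'c \<Rightarrow> 'c \<Rightarrow> 'c set" where
  "pi1_class X A B f = pi0_class (Mor X A B) f"

lemma strict_omega_category_Mor:
  assumes "strict_omega_category X"
  shows "strict_omega_category (Mor X A B)"
proof -
  interpret strict_omega_category X by fact
  show ?thesis
  proof (unfold_locales, goal_cases)
    case (2 x)
    then have x: "x \<in> cells X" by (simp add: Mor_def)
    then obtain n where n: "\<forall>\<alpha>. bdry X \<alpha> n x = x" using finite_dim by blast
    have "bdry X \<alpha> (Suc n) x = x" for \<alpha>
      using bdry_bdry_ge[OF x, of n "Suc n" \<alpha> \<alpha>] n by simp
    then show ?case by (auto simp: Mor_def)
  next
    case (13 x y z w m n)
    then show ?case
      using interchange[of x y z w "Suc m" "Suc n"] by (simp add: Mor_def)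
  qed (auto simp: Mor_def bdry_closed bdry_bdry_less bdry_bdry_ge comp_closed bdry_comp_less
        source_comp target_comp bdry_comp_greater unit_left unit_right comp_assoc)
qed

context strict_omega_category
begin

lemma refl_mor_rel: "C \<in> objects X \<Longrightarrow> (C, C) \<in> mor_rel X"
  using bdry_bdry_ge[of C 0 0 True False] bdry_bdry_ge[of C 0 1 False False]
  by (auto simp: mor_rel_def objects_def)

lemma trans_mor_rel: "trans (mor_rel X)"
proof (rule transI)
  fix A B C assume "(A, B) \<in> mor_rel X" "(B, C) \<in> mor_rel X"
  then obtain f g where *: "A \<in> objects X" "C \<in> objects X" "f \<in> cells X" "g \<in> cells X"
    "bdry X False 1 f = f" "bdry X False 0 f = A" "bdry X True 0 f = B"
    "bdry X False 1 g = g" "bdry X False 0 g = B" "bdry X True 0 g = C"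
    by (auto simp: mor_rel_def)
  then show "(A, C) \<in> mor_rel X"
    using comp_closed[of f g 0] source_comp[of f g 0] target_comp[of f g 0]
      bdry_comp_greater[of f g 0 1 False]
    by (auto simp: mor_rel_def intro!: bexI[of _ "comp X 0 f g"])
qed

lemma equiv_mor_equiv: "equiv (objects X) (mor_equiv X)"
proof (rule equivI)
  show "refl_on (objects X) (mor_equiv X)"
    using refl_mor_rel by (auto simp: refl_on_def mor_equiv_def)
  show "sym (mor_equiv X)" by (auto simp: sym_def mor_equiv_def)
  show "trans (mor_equiv X)"
    using trans_mor_rel by (auto simp: mor_equiv_def intro: trans_Int)
  show "mor_equiv X \<subseteq> objects X \<times> objects X" by (auto simp: mor_equiv_def mor_rel_def)
qed

lemma pi0_class_le_iff:
  assumes "C \<in> objects X" "D \<in> objects X"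
  shows "(pi0_class X C, pi0_class X D) \<in> pi0 X \<longleftrightarrow> (C, D) \<in> mor_rel X"
proof
  assume "(pi0_class X C, pi0_class X D) \<in> pi0 X"
  then obtain C' D' where "(C, C') \<in> mor_rel X" "(C', D') \<in> mor_rel X" "(D', D) \<in> mor_rel X"
    by (auto simp: pi0_class_def pi0_def mor_equiv_def)
  then show "(C, D) \<in> mor_rel X"
    using trans_mor_rel by (meson transD)
next
  assume "(C, D) \<in> mor_rel X"
  moreover have "C \<in> pi0_class X C" "D \<in> pi0_class X D"
    using assms refl_mor_rel by (auto simp: pi0_class_def mor_equiv_def)
  moreover have "pi0_class X C \<in> objects X // mor_equiv X" "pi0_class X D \<in> objects X // mor_equiv X"
    using assms by (auto simp: pi0_class_def intro: quotientI)
  ultimately show "(pi0_class X C, pi0_class X D) \<in> pi0 X"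
    by (auto simp: pi0_def)
qed

lemma Field_pi0: "Field (pi0 X) = objects X // mor_equiv X"
proof
  show "objects X // mor_equiv X \<subseteq> Field (pi0 X)"
  proof
    fix P assume "P \<in> objects X // mor_equiv X"
    then obtain C where "C \<in> objects X" "P = pi0_class X C"
      by (auto simp: quotient_def pi0_class_def)
    then show "P \<in> Field (pi0 X)"
      using pi0_class_le_iff[of C C] refl_mor_rel by (auto simp: Field_def)
  qed
qed (auto simp: Field_def pi0_def)

lemma Partial_order_pi0: "Partial_order (pi0 X)"
proof -
  have cls: "\<exists>C\<in>objects X. P = pi0_class X C" if "P \<in> Field (pi0 X)" for P
    using that unfolding Field_pi0 by (auto simp: quotient_def pi0_class_def)
  have "Refl (pi0 X)"
    using cls by (force simp: refl_on_def pi0_class_le_iff refl_mor_rel)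
  moreover have "trans (pi0 X)"
  proof (rule transI)
    fix P Q R assume PQ: "(P, Q) \<in> pi0 X" and QR: "(Q, R) \<in> pi0 X"
    then have "P \<in> Field (pi0 X)" "Q \<in> Field (pi0 X)" "R \<in> Field (pi0 X)"
      by (auto simp: Field_def)
    then obtain A B C where "A \<in> objects X" "B \<in> objects X" "C \<in> objects X"
      "P = pi0_class X A" "Q = pi0_class X B" "R = pi0_class X C"
      using cls by meson
    then show "(P, R) \<in> pi0 X"
      using PQ QR transD[OF trans_mor_rel] by (auto simp: pi0_class_le_iff)
  qed
  moreover have "antisym (pi0 X)"
  proof (rule antisymI)
    fix P Q assume PQ: "(P, Q) \<in> pi0 X" and QP: "(Q, P) \<in> pi0 X"
    then have "P \<in> Field (pi0 X)" "Q \<in> Field (pi0 X)"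
      by (auto simp: Field_def)
    then obtain A B where AB: "A \<in> objects X" "B \<in> objects X" "P = pi0_class X A" "Q = pi0_class X B"
      using cls by meson
    then have "(A, B) \<in> mor_equiv X"
      using PQ QP by (auto simp: pi0_class_le_iff mor_equiv_def)
    then show "P = Q"
      using equiv_class_eq[OF equiv_mor_equiv] AB by (simp add: pi0_class_def)
  qed
  ultimately show ?thesis
    by (auto simp: partial_order_on_def preorder_on_def Field_def)
qed

end


section \<open>Augmented directed complexes with basis\<close>

text \<open>
  An augmented directed complex with basis is given by its basis, the degrees of the basis elements,
  and the boundary and the augmentation of the basis elements (the latter is only relevant in
  degree \<open>0\<close>).  Chains are finitely supported integral combinations of basis elements; the
  distinguished submonoid in each degree consists of the nonnegative combinations.
\<close>

record 'b adc =
  basis :: "'b set"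
  deg :: "'b \<Rightarrow> nat"
  bd :: "'b \<Rightarrow> ('b \<Rightarrow>\<^sub>0 int)"
  aug :: "'b \<Rightarrow> int"

definition chain_bd :: "'b adc \<Rightarrow> ('b \<Rightarrow>\<^sub>0 int) \<Rightarrow> ('b \<Rightarrow>\<^sub>0 int)" where
  "chain_bd K = frag_extend (bd K)"

definition chain_aug :: "'b adc \<Rightarrow> ('b \<Rightarrow>\<^sub>0 int) \<Rightarrow> int" where
  "chain_aug K c = (\<Sum>b\<in>Poly_Mapping.keys c. Poly_Mapping.lookup c b * aug K b)"

definition pos_chains :: "'b adc \<Rightarrow> nat \<Rightarrow> ('b \<Rightarrow>\<^sub>0 int) set" where
  "pos_chains K i = {c. Poly_Mapping.keys c \<subseteq> {b \<in> basis K. deg K b = i} \<and>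
                        (\<forall>b. 0 \<le> Poly_Mapping.lookup c b)}"

locale augmented_directed_complex =
  fixes K :: "'b adc"
  assumes bd_deg_0: "b \<in> basis K \<Longrightarrow> deg K b = 0 \<Longrightarrow> bd K b = 0"
    and bd_deg_Suc: "b \<in> basis K \<Longrightarrow> deg K b = Suc i
          \<Longrightarrow> Poly_Mapping.keys (bd K b) \<subseteq> {a \<in> basis K. deg K a = i}"
    and bd_bd: "b \<in> basis K \<Longrightarrow> chain_bd K (bd K b) = 0"
    and aug_bd: "b \<in> basis K \<Longrightarrow> deg K b = 1 \<Longrightarrow> chain_aug K (bd K b) = 0"

text \<open>
  Steiner's functor \<open>\<nu>\<close> from augmented directed complexes to strict \<open>\<omega>\<close>-categories.  A cell is a
  table \<open>x\<close> of positive chains, where \<open>x False i\<close> and \<open>x True i\<close> are the source and the target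
  chain in degree \<open>i\<close>.
\<close>

type_synonym 'b table = "bool \<Rightarrow> nat \<Rightarrow> ('b \<Rightarrow>\<^sub>0 int)"

definition nu :: "'b adc \<Rightarrow> 'b table omega_cat" where
  "nu K = \<lparr>
     cells = {x. (\<forall>\<alpha> i. x \<alpha> i \<in> pos_chains K i) \<and>
                 (\<forall>\<alpha>. chain_aug K (x \<alpha> 0) = 1) \<and>
                 (\<forall>\<alpha> i. chain_bd K (x \<alpha> (Suc i)) = x True i - x False i) \<and>
                 (\<exists>N. \<forall>\<alpha>. \<forall>i\<ge>N. x \<alpha> i = 0)},
     bdry = (\<lambda>\<alpha> n x \<beta> i. if i < n then x \<beta> i else if i = n then x \<alpha> n else 0),
     comp = (\<lambda>n x y \<beta> i. if i < n then x \<beta> i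
                          else if i = n then (if \<beta> then y True n else x False n)
                          else x \<beta> i + y \<beta> i) \<rparr>"

lemma chain_bd_0 [simp]: "chain_bd K 0 = 0"
  and chain_bd_add: "chain_bd K (c + d) = chain_bd K c + chain_bd K d"
  by (simp_all add: chain_bd_def frag_extend_add)

lemma zero_pos_chains [simp]: "0 \<in> pos_chains K i"
  and add_pos_chains: "c \<in> pos_chains K i \<Longrightarrow> d \<in> pos_chains K i \<Longrightarrow> c + d \<in> pos_chains K i"
  using Poly_Mapping.keys_add[of c d] by (auto simp: pos_chains_def lookup_add)

lemma nu_top_degree:
  assumes "x \<in> cells (nu K)" "\<And>\<alpha>. x \<alpha> (Suc N) = 0"
  shows "x True N = x False N"
proof -
  have "chain_bd K (x True (Suc N)) = x True N - x False N" using assms(1) by (simp add: nu_def)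
  then show ?thesis using assms(2) by simp
qed

lemma nu_composable_iff:
  "bdry (nu K) True n x = bdry (nu K) False n y \<longleftrightarrow>
     (\<forall>\<alpha>. \<forall>i<n. x \<alpha> i = y \<alpha> i) \<and> x True n = y False n"
proof
  assume "bdry (nu K) True n x = bdry (nu K) False n y"
  then have "bdry (nu K) True n x \<alpha> i = bdry (nu K) False n y \<alpha> i" for \<alpha> i by simp
  from this show "(\<forall>\<alpha>. \<forall>i<n. x \<alpha> i = y \<alpha> i) \<and> x True n = y False n"
    unfolding nu_def by (auto split: if_splits) (metis less_irrefl)+
qed (auto simp: nu_def fun_eq_iff)

theorem strict_omega_category_nu: "strict_omega_category (nu K)"
proof (unfold_locales, goal_cases)
  case (1 x \<alpha> n)
  then show ?case by (auto simp: nu_def Suc_le_eq intro: exI[of _ "Suc n"])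
    (metis Suc_lessI)
next
  case (2 x)
  then obtain N where N: "\<And>\<alpha> i. i \<ge> N \<Longrightarrow> x \<alpha> i = 0" by (auto simp: nu_def)
  have "x True N = x False N" using nu_top_degree[OF 2] N by simp
  then have "bdry (nu K) \<alpha> N x = x" for \<alpha>
    using N by (auto simp: nu_def fun_eq_iff)
  then show ?case by blast
next
  case (5 x y n)
  then have eq: "\<And>\<alpha> i. i < n \<Longrightarrow> x \<alpha> i = y \<alpha> i" "x True n = y False n"
    by (auto simp: nu_composable_iff)
  obtain M N where MN: "\<And>\<alpha> i. i \<ge> M \<Longrightarrow> x \<alpha> i = 0" "\<And>\<alpha> i. i \<ge> N \<Longrightarrow> y \<alpha> i = 0"
    using 5(1,2) by (auto simp: nu_def)
  let ?z = "comp (nu K) n x y"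
  have "?z \<alpha> i = 0" if "i \<ge> max (Suc n) (max M N)" for \<alpha> i
    using that MN by (simp add: nu_def)
  then have "\<exists>N. \<forall>\<alpha>. \<forall>i\<ge>N. ?z \<alpha> i = 0" by blast
  moreover have "?z \<alpha> i \<in> pos_chains K i" for \<alpha> i
    using 5(1,2) by (auto simp: nu_def add_pos_chains)
  moreover have "chain_aug K (?z \<alpha> 0) = 1" for \<alpha>
    using 5(1,2) by (auto simp: nu_def)
  moreover have "chain_bd K (?z \<alpha> (Suc i)) = ?z True i - ?z False i" for \<alpha> i
    using 5(1,2) eq by (cases "Suc i" n rule: linorder_cases)
      (auto simp: nu_def chain_bd_add not_less less_Suc_eq)
  ultimately show ?case by (simp add: nu_def)
next
  case (6 x y n m \<alpha>)
  then show ?case unfolding nu_composable_iff by (simp add: nu_def fun_eq_iff)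
next
  case (7 x y n)
  then show ?case unfolding nu_composable_iff by (simp add: nu_def fun_eq_iff)
next
  case (8 x y n)
  then show ?case unfolding nu_composable_iff by (simp add: nu_def fun_eq_iff)
next
  case (9 x y n m \<alpha>)
  then show ?case unfolding nu_composable_iff by (simp add: nu_def fun_eq_iff)
next
  case (12 x y z n)
  then show ?case unfolding nu_composable_iff by (simp add: nu_def fun_eq_iff add.assoc)
next
  case (13 x y z w m n)
  then show ?case unfolding nu_composable_iff
    by (simp add: nu_def fun_eq_iff add_ac)
qed (simp_all add: nu_def fun_eq_iff)

lemma strict_n_category_nu:
  assumes "\<And>b. b \<in> basis K \<Longrightarrow> deg K b \<le> n"
  shows "strict_n_category n (nu K)"
  unfolding strict_n_category_def
proof (intro conjI ballI allI strict_omega_category_nu)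
  fix x \<alpha> assume x: "x \<in> cells (nu K)"
  have zero: "x \<beta> i = 0" if "i > n" for \<beta> i
  proof -
    have "Poly_Mapping.keys (x \<beta> i) = {}"
      using x assms that by (fastforce simp: nu_def pos_chains_def)
    then show ?thesis by simp
  qed
  then have "x True n = x False n" using nu_top_degree[OF x] by simp
  then show "bdry (nu K) \<alpha> n x = x"
    using zero by (auto simp: nu_def fun_eq_iff) (metis (full_types))
qed


lemma chain_aug_superset:
  assumes "finite A" "Poly_Mapping.keys c \<subseteq> A"
  shows "chain_aug K c = (\<Sum>b\<in>A. Poly_Mapping.lookup c b * aug K b)"
  unfolding chain_aug_def using assms by (intro sum.mono_neutral_left) (auto simp: in_keys_iff)

lemma chain_aug_simps [simp]:
  "chain_aug K 0 = 0"
  "chain_aug K (frag_of b) = aug K b"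
  by (simp_all add: chain_aug_def)

lemma chain_aug_add: "chain_aug K (c + d) = chain_aug K c + chain_aug K d"
proof -
  let ?A = "Poly_Mapping.keys c \<union> Poly_Mapping.keys d"
  have "Poly_Mapping.keys (c + d) \<subseteq> ?A" by (rule Poly_Mapping.keys_add)
  then show ?thesis
    using chain_aug_superset[of ?A c K] chain_aug_superset[of ?A d K]
      chain_aug_superset[of ?A "c + d" K]
    by (simp add: lookup_add algebra_simps sum.distrib)
qed

lemma chain_aug_cmul: "chain_aug K (frag_cmul k c) = k * chain_aug K c"
  using chain_aug_superset[OF _ keys_cmul[of k c], of K]
  by (simp add: chain_aug_def sum_distrib_left mult.assoc)

lemma chain_aug_diff: "chain_aug K (c - d) = chain_aug K c - chain_aug K d"
  using chain_aug_add[of K c "frag_cmul (-1) d"] chain_aug_cmul[of K "-1" d] by simp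

lemma chain_aug_sum: "finite A \<Longrightarrow> chain_aug K (sum g A) = (\<Sum>a\<in>A. chain_aug K (g a))"
  by (induction A rule: finite_induct) (simp_all add: chain_aug_add)


section \<open>Oriented simplices\<close>

text \<open>
  Street's oriental as \<open>nu\<close> of the normalised chains on the \<open>n\<close>-simplex.  A nondegenerate simplex is the nonempty set of its
  vertices, and the face opposite to \<open>a\<close> has index \<open>card {b \<in> S. b < a}\<close>.
\<close>

definition simplex_bd :: "nat set \<Rightarrow> (nat set \<Rightarrow>\<^sub>0 int)" where
  "simplex_bd S = (if card S \<le> 1 then 0
     else \<Sum>a\<in>S. frag_cmul ((-1) ^ card {b \<in> S. b < a}) (frag_of (S - {a})))"

definition simplex_adc :: "nat \<Rightarrow> nat set adc" where
  "simplex_adc n = \<lparr> basis = {S. S \<noteq> {} \<and> S \<subseteq> {0..n}}, deg = (\<lambda>S. card S - 1),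
                     bd = simplex_bd, aug = (\<lambda>_. 1) \<rparr>"

definition oriental :: "nat \<Rightarrow> nat set table omega_cat" where
  "oriental n = nu (simplex_adc n)"

lemma sum_antisym_pairs_zero:
  fixes G :: "'a \<Rightarrow> 'a \<Rightarrow> ('b \<Rightarrow>\<^sub>0 int)"
  assumes "finite S" and anti: "\<And>a c. a \<in> S \<Longrightarrow> c \<in> S \<Longrightarrow> a \<noteq> c \<Longrightarrow> G a c = - G c a"
  shows "(\<Sum>a\<in>S. \<Sum>c\<in>S - {a}. G a c) = 0" (is "?T = 0")
proof -
  have "?T = (\<Sum>a\<in>S. \<Sum>c\<in>S. if a \<noteq> c then G a c else 0)"
    using assms(1) by (intro sum.cong sum.mono_neutral_cong_left) auto
  also have "\<dots> = (\<Sum>c\<in>S. \<Sum>a\<in>S. if a \<noteq> c then G a c else 0)" by (rule sum.swap)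
  also have "\<dots> = (\<Sum>c\<in>S. \<Sum>a\<in>S - {c}. - G c a)"
    using assms(1) anti by (intro sum.cong sum.mono_neutral_cong_right) auto
  also have "\<dots> = - ?T" by (simp add: sum_negf)
  finally have neg: "?T = - ?T" .
  have "t = 0" if "t = - t" for t :: "'b \<Rightarrow>\<^sub>0 int"
  proof (rule poly_mapping_eqI)
    fix b
    have "Poly_Mapping.lookup t b = - Poly_Mapping.lookup t b"
      by (subst that) simp
    then show "Poly_Mapping.lookup t b = Poly_Mapping.lookup 0 b" by simp
  qed
  then show ?thesis using neg by blast
qed

lemma simplex_bd_bd: "frag_extend simplex_bd (simplex_bd S) = 0"
proof (cases "card S \<le> 2")
  case True
  have "simplex_bd (S - {a}) = 0" if "a \<in> S" for a
    using True that by (simp add: simplex_bd_def card_Diff_singleton_if)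
  then show ?thesis
    by (cases "finite S")
      (simp_all add: simplex_bd_def[of S] frag_extend_sum frag_extend_cmul)
next
  case False
  then have fin: "finite S" using card.infinite by fastforce
  define s where "s T a = (-1::int) ^ card {b \<in> T. b < a}" for T :: "nat set" and a
  define G where "G a c = frag_cmul (s S a * s (S - {a}) c) (frag_of (S - {a} - {c}))" for a c
  have anti: "G a c = - G c a" if "a \<in> S" "c \<in> S" "c < a" for a c
  proof -
    have "{b \<in> S. b < a} = insert c {b \<in> S - {c}. b < a}" using that by auto
    then have "s S a = - s (S - {c}) a" using fin by (simp add: s_def)
    moreover have "{b \<in> S - {a}. b < c} = {b \<in> S. b < c}" using that by auto
    then have "s (S - {a}) c = s S c" by (simp add: s_def)
    moreover have "S - {a} - {c} = S - {c} - {a}" by auto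
    ultimately show ?thesis by (simp add: G_def mult.commute)
  qed
  have "frag_extend simplex_bd (simplex_bd S) = (\<Sum>a\<in>S. frag_cmul (s S a) (simplex_bd (S - {a})))"
    using False fin
    by (simp add: simplex_bd_def[of S] frag_extend_sum frag_extend_cmul s_def)
  also have "\<dots> = (\<Sum>a\<in>S. \<Sum>c\<in>S - {a}. G a c)"
    using False fin
    by (intro sum.cong) (auto simp: simplex_bd_def[of "S - {_}"] frag_cmul_sum G_def s_def)
  also have "\<dots> = 0"
  proof (rule sum_antisym_pairs_zero[OF fin])
    fix a c assume "a \<in> S" "c \<in> S" "a \<noteq> c"
    then show "G a c = - G c a"
      using anti[of a c] anti[of c a] by (cases a c rule: linorder_cases) auto
  qed
  finally show ?thesis .
qed

lemma simplex_bd_edge: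
  assumes "a < b"
  shows "simplex_bd {a, b} = frag_of {b} - frag_of {a}"
proof -
  have eqs: "{x \<in> {a, b}. x < a} = {}" "{x \<in> {a, b}. x < b} = {a}"
    "{a, b} - {a} = {b}" "{a, b} - {b} = {a}" using assms by auto
  have "simplex_bd {a, b} =
      frag_cmul ((-1) ^ card {x \<in> {a, b}. x < a}) (frag_of ({a, b} - {a}))
    + frag_cmul ((-1) ^ card {x \<in> {a, b}. x < b}) (frag_of ({a, b} - {b}))"
    using assms by (simp add: simplex_bd_def)
  then show ?thesis unfolding eqs by simp
qed

theorem augmented_directed_complex_simplex: "augmented_directed_complex (simplex_adc n)"
proof
  fix S assume "S \<in> basis (simplex_adc n)" "deg (simplex_adc n) S = 0"
  then show "bd (simplex_adc n) S = 0" by (simp add: simplex_adc_def simplex_bd_def)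
next
  fix S i assume S: "S \<in> basis (simplex_adc n)" "deg (simplex_adc n) S = Suc i"
  then have fin: "finite S" "card S = Suc (Suc i)"
    by (auto simp: simplex_adc_def finite_subset)
  show "Poly_Mapping.keys (bd (simplex_adc n) S) \<subseteq> {T \<in> basis (simplex_adc n). deg (simplex_adc n) T = i}"
  proof
    fix T assume "T \<in> Poly_Mapping.keys (bd (simplex_adc n) S)"
    then have "T \<in> Poly_Mapping.keys
        (\<Sum>a\<in>S. frag_cmul ((-1) ^ card {b \<in> S. b < a}) (frag_of (S - {a})))"
      using fin by (simp add: simplex_adc_def simplex_bd_def)
    then have "T \<in> (\<Union>a\<in>S. Poly_Mapping.keys
        (frag_cmul ((-1) ^ card {b \<in> S. b < a}) (frag_of (S - {a}))))"
      by (rule subsetD[OF Poly_Mapping.keys_sum])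
    then obtain a where a: "a \<in> S" "T = S - {a}" by auto
    then have "card T = Suc i" using fin by simp
    moreover from this have "T \<noteq> {}" by (metis card.empty nat.distinct(1))
    ultimately show "T \<in> {T \<in> basis (simplex_adc n). deg (simplex_adc n) T = i}"
      using S a by (auto simp: simplex_adc_def)
  qed
next
  fix S show "chain_bd (simplex_adc n) (bd (simplex_adc n) S) = 0"
    by (simp add: simplex_adc_def chain_bd_def simplex_bd_bd)
next
  fix S assume "deg (simplex_adc n) S = 1"
  then have "card S = 2" by (simp add: simplex_adc_def)
  then obtain a b where "S = {a, b}" "a < b"
    by (metis card_2_iff insert_commute linorder_neqE_nat)
  then show "chain_aug (simplex_adc n) (bd (simplex_adc n) S) = 0"
    by (simp add: simplex_adc_def simplex_bd_edge chain_aug_diff)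
qed

theorem strict_n_category_oriental: "strict_n_category n (oriental n)"
  unfolding oriental_def
proof (rule strict_n_category_nu)
  fix S assume "S \<in> basis (simplex_adc n)"
  then have "S \<subseteq> {0..n}" by (simp add: simplex_adc_def)
  then show "deg (simplex_adc n) S \<le> n"
    using card_mono[of "{0..n}" S] by (simp add: simplex_adc_def)
qed


section \<open>Oriented cubes\<close>

text \<open>
  On the \<open>\<omega>\<close>-categories of the form \<open>nu K\<close> (for strong Steiner complexes \<open>K\<close>) the Gray tensor
  product is given by \<open>nu K \<boxtimes> nu L = nu (adc_tensor K L)\<close>, so that the \<open>n\<close>-fold Gray tensor power
  of the walking arrow \<open>nu arrow_adc\<close> is \<open>nu\<close> of the \<open>n\<close>-fold tensor power of \<open>arrow_adc\<close>.
\<close>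

definition chain_tensor :: "('a \<Rightarrow>\<^sub>0 int) \<Rightarrow> ('b \<Rightarrow>\<^sub>0 int) \<Rightarrow> ('a \<times> 'b \<Rightarrow>\<^sub>0 int)" where
  "chain_tensor c d = frag_extend (\<lambda>a. frag_extend (\<lambda>b. frag_of (a, b)) d) c"

definition adc_tensor :: "'a adc \<Rightarrow> 'b adc \<Rightarrow> ('a \<times> 'b) adc" where
  "adc_tensor K L = \<lparr>
     basis = basis K \<times> basis L,
     deg = (\<lambda>(a, b). deg K a + deg L b),
     bd = (\<lambda>(a, b). chain_tensor (bd K a) (frag_of b)
                    + frag_cmul ((-1) ^ deg K a) (chain_tensor (frag_of a) (bd L b))),
     aug = (\<lambda>(a, b). aug K a * aug L b) \<rparr>"

text \<open>Transport along an injection, used to realise all tensor powers on lists of basis elements.\<close>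

definition adc_image :: "('a \<Rightarrow> 'b) \<Rightarrow> 'a adc \<Rightarrow> 'b adc" where
  "adc_image f K = \<lparr>
     basis = f ` basis K,
     deg = (\<lambda>b. deg K (inv f b)),
     bd = (\<lambda>b. frag_extend (\<lambda>a. frag_of (f a)) (bd K (inv f b))),
     aug = (\<lambda>b. aug K (inv f b)) \<rparr>"

definition adc_unit :: "'a list adc" where
  "adc_unit = \<lparr> basis = {[]}, deg = (\<lambda>_. 0), bd = (\<lambda>_. 0), aug = (\<lambda>_. 1) \<rparr>"

primrec adc_power :: "'a adc \<Rightarrow> nat \<Rightarrow> 'a list adc" where
  "adc_power K 0 = adc_unit"
| "adc_power K (Suc n) = adc_image (\<lambda>(x, xs). x # xs) (adc_tensor K (adc_power K n))"

datatype arrow_cell = Pt bool | Arr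

definition arrow_adc :: "arrow_cell adc" where
  "arrow_adc = \<lparr>
     basis = UNIV,
     deg = (\<lambda>x. case x of Pt _ \<Rightarrow> 0 | Arr \<Rightarrow> 1),
     bd = (\<lambda>x. case x of Pt _ \<Rightarrow> 0 | Arr \<Rightarrow> frag_of (Pt True) - frag_of (Pt False)),
     aug = (\<lambda>_. 1) \<rparr>"

definition oriented_cube :: "nat \<Rightarrow> arrow_cell list table omega_cat" where
  "oriented_cube n = nu (adc_power arrow_adc n)"

lemma chain_tensor_simps [simp]:
  "chain_tensor 0 d = 0"
  "chain_tensor c 0 = 0"
  "chain_tensor (frag_of a) (frag_of b) = frag_of (a, b)"
  by (simp_all add: chain_tensor_def frag_extend_eq_0)

lemma chain_tensor_diff_left: "chain_tensor (c - c') d = chain_tensor c d - chain_tensor c' d"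
  by (simp add: chain_tensor_def frag_extend_diff)

lemma chain_tensor_diff_right: "chain_tensor c (d - d') = chain_tensor c d - chain_tensor c d'"
proof -
  have "Poly_Mapping.keys c \<subseteq> UNIV" by simp
  then show ?thesis
  proof (induction c rule: frag_induction)
    case (one a)
    then show ?case by (simp add: chain_tensor_def frag_extend_diff)
  qed (simp_all add: chain_tensor_diff_left)
qed

lemma keys_chain_tensor:
  "Poly_Mapping.keys (chain_tensor c d) \<subseteq> Poly_Mapping.keys c \<times> Poly_Mapping.keys d"
proof
  fix p assume "p \<in> Poly_Mapping.keys (chain_tensor c d)"
  then obtain a where a: "a \<in> Poly_Mapping.keys c"
    "p \<in> Poly_Mapping.keys (frag_extend (\<lambda>b. frag_of (a, b)) d)"
    unfolding chain_tensor_def by (blast dest: subsetD[OF keys_frag_extend])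
  from subsetD[OF keys_frag_extend a(2)]
  show "p \<in> Poly_Mapping.keys c \<times> Poly_Mapping.keys d" using a(1) by auto
qed

lemma chain_bd_simps:
  "chain_bd K (frag_of b) = bd K b"
  "chain_bd K (c - d) = chain_bd K c - chain_bd K d"
  "chain_bd K (frag_cmul k c) = frag_cmul k (chain_bd K c)"
  by (simp_all add: chain_bd_def frag_extend_diff frag_extend_cmul)

lemma frag_cmul_diff2: "frag_cmul k (c - d) = frag_cmul k c - frag_cmul k d"
  by (rule poly_mapping_eqI) (simp add: lookup_minus algebra_simps)

lemma chain_bd_tensor:
  assumes "Poly_Mapping.keys c \<subseteq> {a. deg K a = p}"
  shows "chain_bd (adc_tensor K L) (chain_tensor c d) =
           chain_tensor (chain_bd K c) d + frag_cmul ((-1) ^ p) (chain_tensor c (chain_bd L d))"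
  using assms
proof (induction c rule: frag_induction)
  case (one a)
  have "Poly_Mapping.keys d \<subseteq> UNIV" by simp
  then show ?case
  proof (induction d rule: frag_induction)
    case (one b)
    then show ?case using \<open>a \<in> _\<close> by (simp add: chain_bd_simps adc_tensor_def)
  qed (simp_all add: chain_bd_simps chain_tensor_diff_right frag_cmul_diff2)
qed (simp_all add: chain_bd_simps chain_tensor_diff_left frag_cmul_diff2)

lemma chain_aug_tensor:
  "chain_aug (adc_tensor K L) (chain_tensor c d) = chain_aug K c * chain_aug L d"
proof -
  have "Poly_Mapping.keys c \<subseteq> UNIV" by simp
  then show ?thesis
  proof (induction c rule: frag_induction)
    case (one a)
    have "Poly_Mapping.keys d \<subseteq> UNIV" by simp
    then show ?case
    proof (induction d rule: frag_induction)
      case (one b)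
      then show ?case by (simp add: adc_tensor_def)
    qed (simp_all add: chain_aug_diff chain_tensor_diff_right algebra_simps)
  qed (simp_all add: chain_aug_diff chain_tensor_diff_left algebra_simps)
qed

lemma augmented_directed_complex_tensor:
  assumes "augmented_directed_complex K" "augmented_directed_complex L"
  shows "augmented_directed_complex (adc_tensor K L)"
proof -
  interpret K: augmented_directed_complex K by fact
  interpret L: augmented_directed_complex L by fact
  let ?T = "adc_tensor K L"
  have bd: "bd ?T (a, b) = chain_tensor (bd K a) (frag_of b)
                    + frag_cmul ((-1) ^ deg K a) (chain_tensor (frag_of a) (bd L b))" for a b
    by (simp add: adc_tensor_def)
  show ?thesis
  proof
    fix x assume "x \<in> basis ?T" "deg ?T x = 0"
    then show "bd ?T x = 0"
      using K.bd_deg_0 L.bd_deg_0 by (auto simp: adc_tensor_def)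
  next
    fix x i assume x: "x \<in> basis ?T" "deg ?T x = Suc i"
    obtain a b where ab: "x = (a, b)" by fastforce
    have ab': "a \<in> basis K" "b \<in> basis L" "deg K a + deg L b = Suc i"
      using x ab by (auto simp: adc_tensor_def)
    have 1: "Poly_Mapping.keys (chain_tensor (bd K a) (frag_of b)) \<subseteq> {y \<in> basis ?T. deg ?T y = i}"
    proof (cases "deg K a")
      case 0
      then show ?thesis using K.bd_deg_0 ab' by simp
    next
      case (Suc j)
      then show ?thesis
        using K.bd_deg_Suc[OF ab'(1) Suc] ab' keys_chain_tensor[of "bd K a" "frag_of b"]
        by (fastforce simp: adc_tensor_def)
    qed
    have 2: "Poly_Mapping.keys (chain_tensor (frag_of a) (bd L b)) \<subseteq> {y \<in> basis ?T. deg ?T y = i}"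
    proof (cases "deg L b")
      case 0
      then show ?thesis using L.bd_deg_0 ab' by simp
    next
      case (Suc j)
      then show ?thesis
        using L.bd_deg_Suc[OF ab'(2) Suc] ab' keys_chain_tensor[of "frag_of a" "bd L b"]
        by (fastforce simp: adc_tensor_def)
    qed
    show "Poly_Mapping.keys (bd ?T x) \<subseteq> {y \<in> basis ?T. deg ?T y = i}"
      unfolding ab bd
      by (rule order_trans[OF Poly_Mapping.keys_add Un_least[OF 1 order_trans[OF keys_cmul 2]]])
  next
    fix x assume x: "x \<in> basis ?T"
    obtain a b where ab: "x = (a, b)" by fastforce
    have ab': "a \<in> basis K" "b \<in> basis L"
      using x ab by (auto simp: adc_tensor_def)
    have 2: "chain_bd ?T (chain_tensor (frag_of a) (bd L b)) = chain_tensor (bd K a) (bd L b)"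
      using ab' L.bd_bd by (subst chain_bd_tensor[where p = "deg K a"]) (simp_all add: chain_bd_simps)
    show "chain_bd ?T (bd ?T x) = 0"
    proof (cases "deg K a")
      case 0
      then show ?thesis
        using K.bd_deg_0 ab' 2 by (simp add: ab bd chain_bd_simps)
    next
      case (Suc j)
      have "chain_bd ?T (chain_tensor (bd K a) (frag_of b)) =
              frag_cmul ((-1) ^ j) (chain_tensor (bd K a) (bd L b))"
        using ab' K.bd_bd K.bd_deg_Suc[OF ab'(1) Suc]
        by (subst chain_bd_tensor[where p = j]) (auto simp: chain_bd_simps)
      then show ?thesis
        by (simp add: ab bd chain_bd_add chain_bd_simps 2 Suc flip: frag_cmul_distrib)
    qed
  next
    fix x assume x: "x \<in> basis ?T" "deg ?T x = 1"
    obtain a b where ab: "x = (a, b)" by fastforce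
    have ab': "a \<in> basis K" "b \<in> basis L" "deg K a + deg L b = 1"
      using x ab by (auto simp: adc_tensor_def)
    then consider "deg K a = 0" "deg L b = 1" | "deg K a = 1" "deg L b = 0" by linarith
    then show "chain_aug ?T (bd ?T x) = 0"
      using ab' K.bd_deg_0 L.bd_deg_0 K.aug_bd L.aug_bd
      by cases (simp_all add: ab bd chain_aug_add chain_aug_cmul chain_aug_tensor)
  qed
qed

lemma augmented_directed_complex_image:
  assumes "augmented_directed_complex K" and f: "inj f"
  shows "augmented_directed_complex (adc_image f K)"
proof -
  interpret augmented_directed_complex K by fact
  let ?F = "frag_extend (\<lambda>a. frag_of (f a))"
  have keys_F: "Poly_Mapping.keys (?F c) \<subseteq> f ` Poly_Mapping.keys c" for c
    by (rule order_trans[OF keys_frag_extend]) auto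
  have chain_bd_F: "chain_bd (adc_image f K) (?F c) = ?F (chain_bd K c)" for c
  proof -
    have "Poly_Mapping.keys c \<subseteq> UNIV" by simp
    then show ?thesis
      by (induction c rule: frag_induction)
        (simp_all add: chain_bd_simps frag_extend_diff adc_image_def f)
  qed
  have chain_aug_F: "chain_aug (adc_image f K) (?F c) = chain_aug K c" for c
  proof -
    have "Poly_Mapping.keys c \<subseteq> UNIV" by simp
    then show ?thesis
      by (induction c rule: frag_induction)
        (simp_all add: chain_aug_diff frag_extend_diff adc_image_def f)
  qed
  have bd_f: "bd (adc_image f K) (f a) = ?F (bd K a)" for a
    by (simp add: adc_image_def f)
  have basis: "basis (adc_image f K) = f ` basis K" and deg: "deg (adc_image f K) (f a) = deg K a" for a
    by (simp_all add: adc_image_def f)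
  show ?thesis
  proof
    fix b assume "b \<in> basis (adc_image f K)" "deg (adc_image f K) b = 0"
    then show "bd (adc_image f K) b = 0"
      using bd_deg_0 by (auto simp: basis deg bd_f)
  next
    fix b i assume "b \<in> basis (adc_image f K)" "deg (adc_image f K) b = Suc i"
    then obtain a where "b = f a" "a \<in> basis K" "deg K a = Suc i"
      by (auto simp: basis deg)
    then show "Poly_Mapping.keys (bd (adc_image f K) b)
                 \<subseteq> {c \<in> basis (adc_image f K). deg (adc_image f K) c = i}"
      using bd_deg_Suc[of a i] keys_F[of "bd K a"] by (fastforce simp: basis deg bd_f)
  next
    fix b assume "b \<in> basis (adc_image f K)"
    then show "chain_bd (adc_image f K) (bd (adc_image f K) b) = 0"
      using bd_bd by (auto simp: basis bd_f chain_bd_F)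
  next
    fix b assume "b \<in> basis (adc_image f K)" "deg (adc_image f K) b = 1"
    then show "chain_aug (adc_image f K) (bd (adc_image f K) b) = 0"
      using aug_bd by (auto simp: basis deg bd_f chain_aug_F)
  qed
qed

lemma inj_Cons_pair: "inj (\<lambda>(x, xs). x # xs)"
  by (auto simp: inj_def)

lemma augmented_directed_complex_arrow: "augmented_directed_complex arrow_adc"
proof
  fix b i assume "deg arrow_adc b = Suc i"
  then have "b = Arr \<and> i = 0" by (cases b) (auto simp: arrow_adc_def)
  moreover have "Poly_Mapping.keys (frag_of (Pt True) - frag_of (Pt False)) \<subseteq> {Pt True, Pt False}"
    by (rule order_trans[OF keys_diff]) auto
  ultimately show "Poly_Mapping.keys (bd arrow_adc b) \<subseteq> {a \<in> basis arrow_adc. deg arrow_adc a = i}"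
    by (auto simp: arrow_adc_def)
next
  fix b show "chain_bd arrow_adc (bd arrow_adc b) = 0"
    by (cases b) (simp_all add: arrow_adc_def chain_bd_simps)
next
  fix b show "chain_aug arrow_adc (bd arrow_adc b) = 0"
    by (cases b) (simp_all add: arrow_adc_def chain_aug_diff)
next
  fix b assume "deg arrow_adc b = 0"
  then show "bd arrow_adc b = 0" by (cases b) (simp_all add: arrow_adc_def)
qed

theorem augmented_directed_complex_cube: "augmented_directed_complex (adc_power arrow_adc n)"
proof (induction n)
  case 0
  show ?case by unfold_locales (simp_all add: adc_unit_def)
next
  case (Suc n)
  then show ?case
    by (simp add: augmented_directed_complex_image augmented_directed_complex_tensor
        augmented_directed_complex_arrow inj_Cons_pair)
qed

theorem strict_n_category_cube: "strict_n_category n (oriented_cube n)"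
  unfolding oriented_cube_def
proof (rule strict_n_category_nu)
  show "deg (adc_power arrow_adc n) b \<le> n" if "b \<in> basis (adc_power arrow_adc n)" for b
    using that
  proof (induction n arbitrary: b)
    case 0
    then show ?case by (simp add: adc_unit_def)
  next
    case (Suc n)
    then obtain x xs where b: "b = (\<lambda>(x, xs). x # xs) (x, xs)" "xs \<in> basis (adc_power arrow_adc n)"
      by (auto simp: adc_image_def adc_tensor_def)
    have "deg (adc_power arrow_adc (Suc n)) b = deg arrow_adc x + deg (adc_power arrow_adc n) xs"
      unfolding b(1) by (simp only: adc_power.simps adc_image_def adc.simps inv_f_f[OF inj_Cons_pair])
        (simp add: adc_tensor_def)
    moreover have "deg arrow_adc x \<le> 1" by (cases x) (simp_all add: arrow_adc_def)
    ultimately show ?case using Suc.IH[OF b(2)] by simp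
  qed
qed


section \<open>The comparison posets and maps\<close>

definition chain_poset :: "nat \<Rightarrow> nat rel" where
  "chain_poset n = {(i, j). i \<le> j \<and> j \<le> n}"

definition subset_poset :: "'a set \<Rightarrow> 'a set rel" where
  "subset_poset S = {(A, B). A \<subseteq> B \<and> B \<subseteq> S}"

text \<open>
  The poset \<open>{0 < 1}\<close> is \<^typ>\<open>bool\<close> with \<open>False < True\<close>; its \<open>n\<close>-fold product is the set of boolean
  lists of length \<open>n\<close> with the componentwise order.
\<close>

definition bool_power :: "nat \<Rightarrow> bool list set" where
  "bool_power n = {\<delta>. length \<delta> = n}"

definition bool_power_poset :: "nat \<Rightarrow> bool list rel" where
  "bool_power_poset n = {(\<delta>, \<epsilon>). \<delta> \<in> bool_power n \<and> \<epsilon> \<in> bool_power n \<and> list_all2 (\<le>) \<delta> \<epsilon>}"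

text \<open>The option \<open>None\<close> stands for \<open>|\<epsilon> - \<delta>| = -\<infinity>\<close>.\<close>

definition displacement :: "bool list \<Rightarrow> bool list \<Rightarrow> nat option" where
  "displacement \<delta> \<epsilon> =
     (if \<exists>k<length \<delta>. \<delta> ! k > \<epsilon> ! k then None
      else Some (\<Sum>k<length \<delta>. of_bool (\<epsilon> ! k) - of_bool (\<delta> ! k)))"

definition weak_bruhat_step :: "nat \<Rightarrow> (nat \<Rightarrow> nat) \<Rightarrow> (nat \<Rightarrow> nat) \<Rightarrow> bool" where
  "weak_bruhat_step m \<rho> \<sigma> \<longleftrightarrow>
     (\<exists>i\<in>{1..<m}. \<rho> i < \<rho> (i + 1) \<and> \<sigma> = transpose (\<rho> i) (\<rho> (i + 1)) \<circ> \<rho>)"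

fun perm_poset :: "nat option \<Rightarrow> (nat \<Rightarrow> nat) rel" where
  "perm_poset None = {}"
| "perm_poset (Some m) =
     {(\<rho>, \<sigma>). \<rho> permutes {1..m} \<and> \<sigma> permutes {1..m} \<and> (weak_bruhat_step m)\<^sup>*\<^sup>* \<rho> \<sigma>}"

text \<open>
  \<open>nu_obj a\<close> is the object given by a basis element \<open>a\<close> of degree \<open>0\<close>, and \<open>nu_arr a b e\<close> is the
  morphism given by a basis element \<open>e\<close> of degree \<open>1\<close> with boundary \<open>b - a\<close>.
\<close>

definition nu_obj :: "'b \<Rightarrow> 'b table" where
  "nu_obj a = (\<lambda>\<alpha> i. if i = 0 then frag_of a else 0)"

definition nu_arr :: "'b \<Rightarrow> 'b \<Rightarrow> 'b \<Rightarrow> 'b table" where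
  "nu_arr a b e = (\<lambda>\<alpha> i. if i = 0 then frag_of (if \<alpha> then b else a)
                         else if i = 1 then frag_of e else 0)"

fun path_comp :: "'c omega_cat \<Rightarrow> ('v \<Rightarrow> 'c) \<Rightarrow> ('v \<Rightarrow> 'v \<Rightarrow> 'c) \<Rightarrow> 'v list \<Rightarrow> 'c" where
  "path_comp X ob ar [] = undefined"
| "path_comp X ob ar [v] = ob v"
| "path_comp X ob ar (v # w # vs) = comp X 0 (ar v w) (path_comp X ob ar (w # vs))"

definition simplex_vertex :: "nat \<Rightarrow> nat set table" where
  "simplex_vertex i = nu_obj {i}"

definition simplex_edge :: "nat \<Rightarrow> nat \<Rightarrow> nat set table" where
  "simplex_edge i j = nu_arr {i} {j} {i, j}"

text \<open>The composite of the edges between consecutive elements of \<open>{i} \<union> A \<union> {j}\<close>.\<close>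

definition simplex_path :: "nat \<Rightarrow> nat \<Rightarrow> nat \<Rightarrow> nat set \<Rightarrow> nat set table" where
  "simplex_path n i j A =
     path_comp (oriental n) simplex_vertex simplex_edge (sorted_list_of_set ({i} \<union> A \<union> {j}))"

definition cube_vertex :: "bool list \<Rightarrow> arrow_cell list table" where
  "cube_vertex \<delta> = nu_obj (map Pt \<delta>)"

text \<open>Only used for vertices \<open>\<delta>\<close> and \<open>\<epsilon>\<close> that differ in exactly one coordinate.\<close>

definition cube_edge :: "bool list \<Rightarrow> bool list \<Rightarrow> arrow_cell list table" where
  "cube_edge \<delta> \<epsilon> = nu_arr (map Pt \<delta>) (map Pt \<epsilon>) (map2 (\<lambda>a b. if a = b then Pt a else Arr) \<delta> \<epsilon>)"

text \<open>
  Let \<open>ds\<close> be the increasing list of the \<open>m\<close> coordinates in which \<open>\<delta>\<close> and \<open>\<epsilon>\<close> differ, numbered from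
  \<open>1\<close> to \<open>m\<close>.  A permutation \<open>\<rho>\<close> of \<open>{1..m}\<close> is sent to the composite of the edges in the directions
  numbered \<open>\<rho> m, \<dots>, \<rho> 1\<close>, in this order.  With the sign convention of \<open>adc_tensor\<close>, the
  generating 2-cell of the square has the path through \<open>[False, True]\<close> as its source and the path
  through \<open>[True, False]\<close> as its target, so it is this listing, from the last value of \<open>\<rho>\<close> to the
  first, for which the steps of the weak Bruhat order are pointed like the 2-cells.
\<close>

definition diff_coords :: "bool list \<Rightarrow> bool list \<Rightarrow> nat list" where
  "diff_coords \<delta> \<epsilon> = filter (\<lambda>k. \<delta> ! k \<noteq> \<epsilon> ! k) [0..<length \<delta>]"

definition flip_at :: "nat \<Rightarrow> bool list \<Rightarrow> bool list" where
  "flip_at k \<delta> = \<delta>[k := \<not> \<delta> ! k]"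

fun flip_path :: "bool list \<Rightarrow> nat list \<Rightarrow> bool list list" where
  "flip_path \<delta> [] = [\<delta>]"
| "flip_path \<delta> (k # ks) = \<delta> # flip_path (flip_at k \<delta>) ks"

definition cube_path :: "nat \<Rightarrow> bool list \<Rightarrow> bool list \<Rightarrow> (nat \<Rightarrow> nat) \<Rightarrow> arrow_cell list table" where
  "cube_path n \<delta> \<epsilon> \<rho> =
     (let ds = diff_coords \<delta> \<epsilon>; m = length ds in
      path_comp (oriented_cube n) cube_vertex cube_edge
        (flip_path \<delta> (rev (map (\<lambda>p. ds ! (\<rho> p - 1)) [1..<m + 1]))))"

end

theory Submission
  imports Defs
begin

text \<open>
  Both the oriental and the cube are \<open>nu K\<close> for a complex \<open>K\<close> whose basis elements of degree \<open>1\<close>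
  are the edges of a finite acyclic graph on the basis elements of degree \<open>0\<close>.  In every \<open>nu K\<close>
  an object is a positive 0-chain of augmentation \<open>1\<close>, that is, a vertex, and a 1-cell
  from \<open>a\<close> to \<open>b\<close> is a positive 1-chain with boundary \<open>b - a\<close>: a unit flow.  In an acyclic graph
  a unit flow is carried by one directed walk, so that the 1-cells are the walks of the graph
  (\<open>paths_imp_walk\<close>).  In the simplex a walk from \<open>i\<close> to \<open>j\<close> is given by the set of its
  intermediate vertices, and in the cube a walk from \<open>\<delta>\<close> to \<open>\<epsilon>\<close> is given by the order in which it
  turns the coordinates that differ from \<open>False\<close> to \<open>True\<close>.  This yields \<open>\<pi>\<^sub>0\<close> and the elements of
  \<open>\<pi>\<^sub>1\<close>.

  For the order on \<open>\<pi>\<^sub>1\<close>, there is a 2-cell between parallel 1-cells \<open>p\<close> and \<open>q\<close> exactly if \<open>q - p\<close>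
  is the boundary of a positive 2-chain (\<open>bounds_le\<close>).  One basis element of degree \<open>2\<close> gives an
  elementary move: in the simplex the insertion of one vertex (\<open>simplex_chain_insert\<close>), in the cube
  the exchange of two adjacent turns (\<open>bounds_le_swap\<close>).  Conversely, 2-cells are
  excluded by linear functionals on 1-chains that are nonnegative on the boundaries of all basis
  elements of degree \<open>2\<close>, since these do not decrease along 2-cells (\<open>bounds_le_pairing_mono\<close>).  In the simplex the out-degree of a vertex is such a functional, and
  its values on a path determine the set of visited vertices.  In the cube, for coordinates
  \<open>k < l\<close>, the number of edges in direction \<open>l\<close> with coordinate \<open>k\<close> already turned is one; its
  value tells whether \<open>k\<close> is turned before \<open>l\<close>, so that the inversion set can only grow.  The
  weak Bruhat order is the containment of inversion sets
  (\<open>inversions_subset_imp_weak_bruhat\<close>), which closes the circle.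
\<close>


section \<open>Linear functionals on chains\<close>

text \<open>
  The augmentation of a complex is an arbitrary linear functional on chains, so the functional with
  prescribed values \<open>\<phi>\<close> on basis elements is the augmentation of a complex built for that purpose.
\<close>

definition pairing :: "('b \<Rightarrow> int) \<Rightarrow> ('b \<Rightarrow>\<^sub>0 int) \<Rightarrow> int" where
  "pairing \<phi> = chain_aug \<lparr>basis = {}, deg = (\<lambda>_. 0), bd = (\<lambda>_. 0), aug = \<phi>\<rparr>"

lemma pairing_simps [simp]:
  "pairing \<phi> 0 = 0"
  "pairing \<phi> (frag_of b) = \<phi> b"
  "pairing \<phi> (c + d) = pairing \<phi> c + pairing \<phi> d"
  "pairing \<phi> (c - d) = pairing \<phi> c - pairing \<phi> d"
  by (simp_all add: pairing_def chain_aug_add chain_aug_diff)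

lemma pairing_eq_sum:
  "pairing \<phi> c = (\<Sum>b\<in>Poly_Mapping.keys c. Poly_Mapping.lookup c b * \<phi> b)"
  by (simp add: pairing_def chain_aug_def)

lemma pairing_chain_bd: "pairing \<phi> (chain_bd K c) = pairing (\<lambda>b. pairing \<phi> (bd K b)) c"
proof -
  have "Poly_Mapping.keys c \<subseteq> UNIV" by simp
  then show ?thesis
    by (induction c rule: frag_induction) (simp_all add: chain_bd_simps)
qed

lemma pairing_nonneg:
  assumes "c \<in> pos_chains K i" "\<And>b. b \<in> basis K \<Longrightarrow> deg K b = i \<Longrightarrow> 0 \<le> \<phi> b"
  shows "0 \<le> pairing \<phi> c"
  unfolding pairing_eq_sum using assms by (intro sum_nonneg) (auto simp: pos_chains_def)

lemma pairing_pos: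
  assumes "c \<in> pos_chains K i" "c \<noteq> 0" "\<And>b. b \<in> basis K \<Longrightarrow> deg K b = i \<Longrightarrow> 0 < \<phi> b"
  shows "0 < pairing \<phi> c"
  unfolding pairing_eq_sum
proof (rule sum_pos)
  fix b assume b: "b \<in> Poly_Mapping.keys c"
  then have "0 < \<phi> b" "0 \<le> Poly_Mapping.lookup c b" "Poly_Mapping.lookup c b \<noteq> 0"
    using assms by (auto simp: pos_chains_def in_keys_iff)
  then show "0 < Poly_Mapping.lookup c b * \<phi> b" by simp
qed (use assms in auto)

lemma frag_of_diff_eqD:
  assumes "frag_of b - frag_of a = frag_of d - frag_of c" "a \<noteq> b"
  shows "a = c" "b = d"
proof -
  have *: "Poly_Mapping.lookup (frag_of b - frag_of a) x = Poly_Mapping.lookup (frag_of d - frag_of c) x"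
    for x by (simp add: assms(1))
  show "a = c" "b = d"
    using *[of a] *[of b] assms(2) by (auto simp: lookup_minus when_def split: if_splits)
qed

lemma frag_of_pos_chains: "b \<in> basis K \<Longrightarrow> deg K b = i \<Longrightarrow> frag_of b \<in> pos_chains K i"
  by (auto simp: pos_chains_def)

lemma minus_frag_of_pos_chains:
  assumes "c \<in> pos_chains K i" "b \<in> Poly_Mapping.keys c"
  shows "c - frag_of b \<in> pos_chains K i"
proof -
  have "Poly_Mapping.keys (c - frag_of b) \<subseteq> Poly_Mapping.keys c"
    using keys_diff[of c "frag_of b"] assms(2) by auto
  moreover have "0 < Poly_Mapping.lookup c b"
    using assms by (auto simp: pos_chains_def in_keys_iff order_less_le)
  ultimately show ?thesis
    using assms(1) by (auto simp: pos_chains_def lookup_minus lookup_frag_of when_def)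
qed

text \<open>
  For parallel 1-cells of \<open>nu K\<close> with chains \<open>p\<close> and \<open>q\<close> in degree \<open>1\<close> this says that there is a
  2-cell from the first to the second.
\<close>

definition bounds_le :: "'b adc \<Rightarrow> ('b \<Rightarrow>\<^sub>0 int) \<Rightarrow> ('b \<Rightarrow>\<^sub>0 int) \<Rightarrow> bool" where
  "bounds_le K p q \<longleftrightarrow> (\<exists>c\<in>pos_chains K 2. chain_bd K c = q - p)"

text \<open>
  The absence of 2-cells is detected by functionals that are nonnegative on the boundaries of the
  basis elements, and hence on the boundaries of all positive chains.
\<close>

lemma bounds_le_pairing_mono:
  assumes "bounds_le K p q" "\<And>b. b \<in> basis K \<Longrightarrow> deg K b = 2 \<Longrightarrow> 0 \<le> pairing \<phi> (bd K b)"
  shows "pairing \<phi> p \<le> pairing \<phi> q"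
proof -
  obtain c where c: "c \<in> pos_chains K 2" "chain_bd K c = q - p"
    using assms(1) by (auto simp: bounds_le_def)
  have "0 \<le> pairing \<phi> (chain_bd K c)"
    unfolding pairing_chain_bd by (rule pairing_nonneg[OF c(1)]) (rule assms(2))
  then show ?thesis by (simp add: c(2))
qed

lemma bounds_le_refl [simp]: "bounds_le K p p"
  unfolding bounds_le_def by (rule bexI[of _ 0]) simp_all

lemma bounds_le_trans [trans]: "bounds_le K p q \<Longrightarrow> bounds_le K q r \<Longrightarrow> bounds_le K p r"
  unfolding bounds_le_def
proof (elim bexE)
  fix c d assume "c \<in> pos_chains K 2" "d \<in> pos_chains K 2"
    "chain_bd K c = q - p" "chain_bd K d = r - q"
  then show "\<exists>c\<in>pos_chains K 2. chain_bd K c = r - p"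
    by (intro bexI[of _ "c + d"]) (simp_all add: chain_bd_add add_pos_chains)
qed

lemma bounds_le_bd:
  assumes "b \<in> basis K" "deg K b = 2" "q = p + bd K b"
  shows "bounds_le K p q"
  unfolding bounds_le_def using assms frag_of_pos_chains[of b K 2]
  by (intro bexI[of _ "frag_of b"]) (simp_all add: chain_bd_simps)


section \<open>Comparison with \<open>\<pi>\<^sub>0\<close> of a strict \<open>\<omega>\<close>-category\<close>

text \<open>
  The order of \<open>\<pi>\<^sub>0\<close> reflects the existence of morphisms between representatives, so a map that
  turns a given order into this relation is injective on classes by antisymmetry of the given order.
\<close>

lemma poset_iso_pi0I:
  assumes "strict_omega_category X"
    and "r \<subseteq> A \<times> A" "antisym r"
    and f: "f ` A = objects X"
    and r: "\<And>a b. a \<in> A \<Longrightarrow> b \<in> A \<Longrightarrow> (a, b) \<in> r \<longleftrightarrow> (f a, f b) \<in> mor_rel X"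
  shows "poset_iso r (pi0 X) (\<lambda>a. pi0_class X (f a))"
proof -
  interpret strict_omega_category X by fact
  have fA: "f a \<in> objects X" if "a \<in> A" for a using f that by blast
  have refl: "(a, a) \<in> r" if "a \<in> A" for a using r fA refl_mor_rel that by blast
  then have Field: "Field r = A" using assms(2) by (auto simp: Field_def)
  have iff: "(a, b) \<in> r \<longleftrightarrow> (pi0_class X (f a), pi0_class X (f b)) \<in> pi0 X"
    if "a \<in> A" "b \<in> A" for a b
    using that r fA pi0_class_le_iff by simp
  have "trans r"
  proof (rule transI)
    fix a b c assume "(a, b) \<in> r" "(b, c) \<in> r"
    moreover from this have "a \<in> A" "b \<in> A" "c \<in> A" using assms(2) by auto
    ultimately show "(a, c) \<in> r" using r transD[OF trans_mor_rel] by meson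
  qed
  moreover have "Refl r" using refl Field assms(2) by (auto simp: refl_on_def)
  ultimately have "Partial_order r"
    using assms(2,3) Field by (auto simp: partial_order_on_def preorder_on_def)
  moreover have "inj_on (\<lambda>a. pi0_class X (f a)) A"
  proof (rule inj_onI)
    fix a b assume "a \<in> A" "b \<in> A" "pi0_class X (f a) = pi0_class X (f b)"
    then have "(a, b) \<in> r" "(b, a) \<in> r" using iff[of a b] iff[of b a] iff[of a a] refl by auto
    then show "a = b" using assms(3) by (auto dest: antisymD)
  qed
  moreover have "(\<lambda>a. pi0_class X (f a)) ` A = Field (pi0 X)"
    unfolding Field_pi0 quotient_def pi0_class_def f[symmetric] by auto
  ultimately show ?thesis
    unfolding poset_iso_def iso_iff2 Field bij_betw_def using iff Partial_order_pi0 by auto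
qed


section \<open>Objects and morphisms of \<open>nu K\<close> in low dimensions\<close>

text \<open>
  The shape common to \<^const>\<open>nu_obj\<close>, \<^const>\<open>nu_arr\<close> and all their composites.
\<close>

definition path_table :: "'b \<Rightarrow> 'b \<Rightarrow> ('b \<Rightarrow>\<^sub>0 int) \<Rightarrow> 'b table" where
  "path_table a b p = (\<lambda>\<alpha> i. if i = 0 then frag_of (if \<alpha> then b else a) else if i = 1 then p else 0)"

lemma nu_obj_eq_path_table: "nu_obj a = path_table a a 0"
  by (auto simp: nu_obj_def path_table_def fun_eq_iff)

fun path_chain :: "('v \<Rightarrow> 'v \<Rightarrow> 'b) \<Rightarrow> 'v list \<Rightarrow> ('b \<Rightarrow>\<^sub>0 int)" where
  "path_chain e (v # w # vs) = frag_of (e v w) + path_chain e (w # vs)"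
| "path_chain e vs = 0"

text \<open>
  Composition along objects keeps the source of the first and the target of the second factor and
  adds the chains in degree \<open>1\<close>.
\<close>

lemma path_comp_eq_path_table:
  assumes "vs \<noteq> []"
  shows "path_comp (nu K) (\<lambda>v. nu_obj (f v)) (\<lambda>v w. nu_arr (f v) (f w) (e v w)) vs =
           path_table (f (hd vs)) (f (last vs)) (path_chain e vs)"
  using assms
proof (induction vs rule: induct_list012)
  case (2 v)
  then show ?case by (simp add: nu_obj_eq_path_table)
next
  case (3 v w vs)
  then show ?case by (auto simp: nu_def nu_arr_def path_table_def fun_eq_iff)
qed simp

lemma objects_Mor:
  "objects (Mor X A B) =
     {x \<in> cells X. bdry X False 1 x = x \<and> bdry X False 0 x = A \<and> bdry X True 0 x = B}"
  by (auto simp: objects_def Mor_def)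

text \<open>
  The 1-cells of \<open>nu K\<close> form the free category on a graph as soon as every basis element of degree
  \<open>1\<close> is an edge between two vertices and no closed walk consists of such edges; a height function
  on the vertices that increases along the edges excludes closed walks.
\<close>

locale graph_like_complex = augmented_directed_complex K for K :: "'b adc" +
  fixes height :: "'b \<Rightarrow> int"
  assumes aug_vertex: "a \<in> basis K \<Longrightarrow> deg K a = 0 \<Longrightarrow> aug K a = 1"
    and edge_ends: "e \<in> basis K \<Longrightarrow> deg K e = 1 \<Longrightarrow>
      \<exists>a b. a \<in> basis K \<and> deg K a = 0 \<and> b \<in> basis K \<and> deg K b = 0 \<and>
            bd K e = frag_of b - frag_of a \<and> height a < height b"
begin

definition vertices :: "'b set" where
  "vertices = {a \<in> basis K. deg K a = 0}"

definition paths :: "'b \<Rightarrow> 'b \<Rightarrow> ('b \<Rightarrow>\<^sub>0 int) set" where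
  "paths a b = {p \<in> pos_chains K 1. chain_bd K p = frag_of b - frag_of a}"

text \<open>
  Removing a vertex of the support from the chain leaves a positive chain of augmentation \<open>0\<close>, and
  such a chain vanishes.
\<close>

lemma pos_chain_aug_1:
  assumes c: "c \<in> pos_chains K 0" and aug: "chain_aug K c = 1"
  obtains a where "a \<in> vertices" "c = frag_of a"
proof -
  have aug_eq: "chain_aug K d = pairing (\<lambda>_. 1) d" if "d \<in> pos_chains K 0" for d
    using that aug_vertex unfolding chain_aug_def pairing_eq_sum
    by (intro sum.cong) (auto simp: pos_chains_def)
  have "c \<noteq> 0" using aug by auto
  then obtain a where a: "a \<in> Poly_Mapping.keys c" by fastforce
  have d: "c - frag_of a \<in> pos_chains K 0" by (rule minus_frag_of_pos_chains[OF c a])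
  have "pairing (\<lambda>_. 1) (c - frag_of a) = 0"
    using aug_eq[OF c] aug by simp
  then have "c - frag_of a = 0" using pairing_pos[OF d, of "\<lambda>_. 1"] by auto
  then have "c = frag_of a" by simp
  moreover have "a \<in> vertices" using c a by (auto simp: vertices_def pos_chains_def)
  ultimately show ?thesis using that by blast
qed

lemma path_table_in_cells:
  assumes "a \<in> vertices" "b \<in> vertices" "p \<in> paths a b"
  shows "path_table a b p \<in> cells (nu K)"
proof -
  have "path_table a b p \<alpha> i = 0" if "i \<ge> 2" for \<alpha> i using that by (simp add: path_table_def)
  then have "\<exists>N. \<forall>\<alpha>. \<forall>i\<ge>N. path_table a b p \<alpha> i = 0" by blast
  then show ?thesis
    using assms
    by (auto simp: path_table_def nu_def paths_def vertices_def frag_of_pos_chains aug_vertex)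
qed

lemma zero_paths: "0 \<in> paths a a"
  by (simp add: paths_def)

lemma objects_nu: "objects (nu K) = nu_obj ` vertices"
proof
  show "objects (nu K) \<subseteq> nu_obj ` vertices"
  proof
    fix x assume x: "x \<in> objects (nu K)"
    then have "x \<in> cells (nu K)" "bdry (nu K) False 0 x = x" by (auto simp: objects_def)
    then have *: "x False 0 \<in> pos_chains K 0" "chain_aug K (x False 0) = 1"
      and x_eq: "x = (\<lambda>\<beta> i. if i = 0 then x False 0 else 0)" by (auto simp: nu_def)
    obtain a where "a \<in> vertices" "x False 0 = frag_of a" using pos_chain_aug_1[OF *] .
    moreover from this have "x = nu_obj a" by (subst x_eq) (simp add: nu_obj_def fun_eq_iff)
    ultimately show "x \<in> nu_obj ` vertices" by blast
  qed
  have "bdry (nu K) False 0 (nu_obj a) = nu_obj a" for a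
    by (simp add: nu_def nu_obj_def fun_eq_iff)
  then show "nu_obj ` vertices \<subseteq> objects (nu K)"
    using path_table_in_cells[OF _ _ zero_paths]
    by (auto simp: objects_def nu_obj_eq_path_table)
qed

lemma objects_Mor_nu:
  assumes "a \<in> vertices" "b \<in> vertices"
  shows "objects (Mor (nu K) (nu_obj a) (nu_obj b)) = path_table a b ` paths a b" (is "?L = ?R")
proof
  show "?L \<subseteq> ?R"
  proof
    fix x assume "x \<in> ?L"
    then have x: "x \<in> cells (nu K)" "bdry (nu K) False 1 x = x"
      "bdry (nu K) False 0 x = nu_obj a" "bdry (nu K) True 0 x = nu_obj b"
      by (auto simp: objects_def Mor_def)
    have "x False 0 = frag_of a" "x True 0 = frag_of b"
      using fun_cong[OF fun_cong[OF x(3)], of True 0] fun_cong[OF fun_cong[OF x(4)], of True 0]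
      by (simp_all add: nu_def nu_obj_def)
    moreover have x_eq: "(if i < 1 then x \<beta> i else if i = 1 then x False 1 else 0) = x \<beta> i" for \<beta> i
      using fun_cong[OF fun_cong[OF x(2)], of \<beta> i] by (simp add: nu_def cong: if_cong)
    have "x \<beta> i = 0" if "i > 1" for \<beta> i using x_eq[where \<beta> = \<beta> and i = i] that by simp
    moreover have "x True 1 = x False 1" using x_eq[where \<beta> = True and i = 1] by simp
    ultimately have eq: "x = path_table a b (x False 1)"
      unfolding path_table_def fun_eq_iff
      by (metis (full_types) One_nat_def less_one nat_neq_iff)
    have "x False 1 \<in> paths a b"
      using x(1) \<open>x False 0 = _\<close> \<open>x True 0 = _\<close> by (auto simp: paths_def nu_def)
    then show "x \<in> ?R" using eq by blast
  qed
  have "bdry (nu K) False 1 (path_table a b p) = path_table a b p"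
    "bdry (nu K) False 0 (path_table a b p) = nu_obj a"
    "bdry (nu K) True 0 (path_table a b p) = nu_obj b" for p
    by (auto simp: nu_def nu_obj_def path_table_def fun_eq_iff)
  then show "?R \<subseteq> ?L"
    using path_table_in_cells[OF assms] by (auto simp: objects_def Mor_def)
qed

lemma mor_rel_nu_iff:
  assumes "a \<in> vertices" "b \<in> vertices"
  shows "(nu_obj a, nu_obj b) \<in> mor_rel (nu K) \<longleftrightarrow> paths a b \<noteq> {}"
proof -
  have "(nu_obj a, nu_obj b) \<in> mor_rel (nu K) \<longleftrightarrow> objects (Mor (nu K) (nu_obj a) (nu_obj b)) \<noteq> {}"
    using assms by (auto simp: mor_rel_def objects_nu objects_Mor)
  then show ?thesis using objects_Mor_nu[OF assms] by simp
qed

text \<open>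
  A 2-cell from \<open>p\<close> to \<open>q\<close> is a table with \<open>p\<close> and \<open>q\<close> in degree \<open>1\<close> and a single chain in
  degree \<open>2\<close>, and the cell condition asks this chain to have boundary \<open>q - p\<close>.
\<close>

lemma mor_rel_Mor_nu_iff:
  assumes "a \<in> vertices" "b \<in> vertices" "p \<in> paths a b" "q \<in> paths a b"
  shows "(path_table a b p, path_table a b q) \<in> mor_rel (Mor (nu K) (nu_obj a) (nu_obj b))
           \<longleftrightarrow> bounds_le K p q"
proof
  assume "(path_table a b p, path_table a b q) \<in> mor_rel (Mor (nu K) (nu_obj a) (nu_obj b))"
  then obtain f where f: "f \<in> cells (nu K)" "bdry (nu K) False 2 f = f"
    "bdry (nu K) False 1 f = path_table a b p" "bdry (nu K) True 1 f = path_table a b q"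
    by (auto simp: mor_rel_def Mor_def numeral_2_eq_2)
  have "f False 1 = p" "f True 1 = q"
    using fun_cong[OF fun_cong[OF f(3)], of True 1] fun_cong[OF fun_cong[OF f(4)], of True 1]
    by (simp_all add: nu_def path_table_def)
  then have "f False 2 \<in> pos_chains K 2" "chain_bd K (f False 2) = q - p"
    using f(1) by (auto simp: nu_def numeral_2_eq_2)
  then show "bounds_le K p q" by (auto simp: bounds_le_def)
next
  assume "bounds_le K p q"
  then obtain c where c: "c \<in> pos_chains K 2" "chain_bd K c = q - p" by (auto simp: bounds_le_def)
  define f :: "'b table" where "f = (\<lambda>\<alpha> i. if i = 0 then frag_of (if \<alpha> then b else a)
    else if i = 1 then (if \<alpha> then q else p) else if i = 2 then c else 0)"
  have "f \<alpha> i = 0" if "i \<ge> 3" for \<alpha> i using that by (simp add: f_def)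
  then have "\<exists>N. \<forall>\<alpha>. \<forall>i\<ge>N. f \<alpha> i = 0" by blast
  then have "f \<in> cells (nu K)"
    using assms c
    by (auto simp: f_def nu_def paths_def vertices_def frag_of_pos_chains aug_vertex numeral_2_eq_2)
  moreover have "bdry (nu K) False 2 f = f" "bdry (nu K) False 0 f = nu_obj a"
    "bdry (nu K) True 0 f = nu_obj b"
    "bdry (nu K) False 1 f = path_table a b p" "bdry (nu K) True 1 f = path_table a b q"
    by (auto simp: f_def nu_def nu_obj_def path_table_def fun_eq_iff)
  ultimately show "(path_table a b p, path_table a b q) \<in> mor_rel (Mor (nu K) (nu_obj a) (nu_obj b))"
    using objects_Mor_nu[OF assms(1,2)] assms(3,4)
    by (auto simp: mor_rel_def Mor_def numeral_2_eq_2 intro!: bexI[of _ f])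
qed

text \<open>
  An indexing of the 1-cells from \<open>a\<close> to \<open>b\<close> identifies \<open>\<pi>\<^sub>1\<close> with the index set once it turns the
  given order into the existence of a positive 2-chain.
\<close>

lemma poset_iso_pi1I:
  assumes "a \<in> vertices" "b \<in> vertices" "r \<subseteq> A \<times> A" "antisym r"
    and "f ` A = paths a b"
    and "\<And>x y. x \<in> A \<Longrightarrow> y \<in> A \<Longrightarrow> (x, y) \<in> r \<longleftrightarrow> bounds_le K (f x) (f y)"
    and "\<And>x. x \<in> A \<Longrightarrow> g x = path_table a b (f x)"
  shows "poset_iso r (pi1 (nu K) (nu_obj a) (nu_obj b))
           (\<lambda>x. pi1_class (nu K) (nu_obj a) (nu_obj b) (g x))"
  unfolding pi1_def pi1_class_def
proof (rule poset_iso_pi0I[where A = A])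
  show "g ` A = objects (Mor (nu K) (nu_obj a) (nu_obj b))"
    unfolding objects_Mor_nu[OF assms(1,2)] assms(5)[symmetric] using assms(7) by force
  show "(x, y) \<in> r \<longleftrightarrow> (g x, g y) \<in> mor_rel (Mor (nu K) (nu_obj a) (nu_obj b))"
    if "x \<in> A" "y \<in> A" for x y
  proof -
    have "f x \<in> paths a b" "f y \<in> paths a b" using assms(5) that by auto
    then show ?thesis using assms(6)[OF that] assms(7) that mor_rel_Mor_nu_iff[OF assms(1,2)] by simp
  qed
qed (simp_all add: assms strict_omega_category_Mor strict_omega_category_nu)

inductive walk :: "'b \<Rightarrow> 'b \<Rightarrow> ('b \<Rightarrow>\<^sub>0 int) \<Rightarrow> bool" where
  walk_refl: "a \<in> vertices \<Longrightarrow> walk a a 0"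
| walk_step: "e \<in> basis K \<Longrightarrow> deg K e = 1 \<Longrightarrow> a \<in> vertices \<Longrightarrow> a' \<in> vertices \<Longrightarrow>
    bd K e = frag_of a' - frag_of a \<Longrightarrow> walk a' b p \<Longrightarrow> walk a b (frag_of e + p)"

lemma walk_imp_paths: "walk a b p \<Longrightarrow> p \<in> paths a b"
  by (induction rule: walk.induct)
    (auto simp: paths_def chain_bd_add chain_bd_simps add_pos_chains frag_of_pos_chains)

text \<open>
  Heights increase along the edges of \<open>p\<close>, which forces \<open>a \<noteq> b\<close>.  Then the boundary of \<open>p\<close> is
  negative at \<open>a\<close>, and this needs an edge in the support of \<open>p\<close> that starts at \<open>a\<close>.
\<close>

lemma edge_out_of_source:
  assumes "p \<in> paths a b" "p \<noteq> 0"
  shows "\<exists>e\<in>Poly_Mapping.keys p. \<exists>a'\<in>vertices. bd K e = frag_of a' - frag_of a"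
proof -
  have p: "p \<in> pos_chains K 1" and bd_p: "chain_bd K p = frag_of b - frag_of a"
    using assms(1) by (auto simp: paths_def)
  have "0 < pairing (\<lambda>e. pairing height (bd K e)) p"
  proof (rule pairing_pos[OF p assms(2)])
    fix e assume "e \<in> basis K" "deg K e = 1"
    then show "0 < pairing height (bd K e)" using edge_ends[of e] by auto
  qed
  then have "height a < height b"
    unfolding pairing_chain_bd[symmetric] bd_p by simp
  then have "a \<noteq> b" by auto
  have "pairing (\<lambda>x. of_bool (x = a)) (chain_bd K p) < 0"
    using \<open>a \<noteq> b\<close> by (simp add: bd_p)
  then have neg: "pairing (\<lambda>e. pairing (\<lambda>x. of_bool (x = a)) (bd K e)) p < 0"
    by (simp add: pairing_chain_bd)
  have "\<exists>e\<in>Poly_Mapping.keys p. pairing (\<lambda>x. of_bool (x = a)) (bd K e) < 0"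
  proof (rule ccontr)
    assume "\<not> ?thesis"
    then have "0 \<le> pairing (\<lambda>e. pairing (\<lambda>x. of_bool (x = a)) (bd K e)) p"
      using p unfolding pairing_eq_sum[of _ p]
      by (intro sum_nonneg) (auto simp: pos_chains_def not_less)
    then show False using neg by simp
  qed
  then obtain e where e: "e \<in> Poly_Mapping.keys p" "pairing (\<lambda>x. of_bool (x = a)) (bd K e) < 0"
    by blast
  have "e \<in> basis K" "deg K e = 1" using p e(1) by (auto simp: pos_chains_def)
  then obtain c a' where "a' \<in> vertices" "bd K e = frag_of a' - frag_of c"
    using edge_ends[of e] unfolding vertices_def by blast
  moreover from this have "c = a" using e(2) by (auto split: if_splits)
  ultimately show ?thesis using e(1) by blast
qed

text \<open>
  A positive 1-chain whose boundary is a difference of two vertices is a unit flow, and in the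
  absence of closed walks a unit flow is carried by a single walk: splitting off an edge that leaves
  the source gives a smaller unit flow, until nothing is left.
\<close>

theorem paths_imp_walk:
  assumes "a \<in> vertices" "b \<in> vertices" "p \<in> paths a b"
  shows "walk a b p"
proof -
  define N where "N = nat (pairing (\<lambda>_. 1) p)"
  then show ?thesis using assms
  proof (induction N arbitrary: a p rule: less_induct)
    case (less N)
    show ?case
    proof (cases "p = 0")
      case True
      then have "frag_of b = frag_of a" using less.prems(4) by (simp add: paths_def)
      then show ?thesis using True less.prems(2) by (auto simp: frag_of_eq intro: walk_refl)
    next
      case False
      then obtain e a' where e: "e \<in> Poly_Mapping.keys p" "a' \<in> vertices"
        "bd K e = frag_of a' - frag_of a"
        using edge_out_of_source[OF less.prems(4)] by blast
      have p: "p \<in> pos_chains K 1" using less.prems(4) by (simp add: paths_def)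
      then have e': "e \<in> basis K" "deg K e = 1" using e(1) by (auto simp: pos_chains_def)
      have "p - frag_of e \<in> paths a' b"
        using less.prems(4) minus_frag_of_pos_chains[OF p e(1)] e(3)
        by (simp add: paths_def chain_bd_simps)
      moreover have "0 < pairing (\<lambda>_. 1) p" using pairing_pos[OF p False] by simp
      then have "nat (pairing (\<lambda>_. 1) (p - frag_of e)) < N" using less.prems(1) by simp
      ultimately have "walk a' b (p - frag_of e)" using less.IH less.prems(3) e(2) by blast
      from walk_step[OF e' less.prems(2) e(2,3) this] show ?thesis by simp
    qed
  qed
qed

lemma paths_eq_walks:
  assumes "a \<in> vertices" "b \<in> vertices"
  shows "paths a b = {p. walk a b p}"
  using assms paths_imp_walk walk_imp_paths by blast

end


section \<open>Oriented simplices\<close>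

lemma simplex_bd_triangle:
  assumes "a < b" "b < c"
  shows "simplex_bd {a, b, c} = frag_of {a, b} + frag_of {b, c} - frag_of {a, c}"
proof -
  have eqs: "{x \<in> {a, b, c}. x < a} = {}" "{x \<in> {a, b, c}. x < b} = {a}"
    "{x \<in> {a, b, c}. x < c} = {a, b}"
    "{a, b, c} - {a} = {b, c}" "{a, b, c} - {b} = {a, c}" "{a, b, c} - {c} = {a, b}"
    using assms by auto
  have "simplex_bd {a, b, c} =
      frag_cmul ((-1) ^ card {x \<in> {a, b, c}. x < a}) (frag_of ({a, b, c} - {a}))
    + (frag_cmul ((-1) ^ card {x \<in> {a, b, c}. x < b}) (frag_of ({a, b, c} - {b}))
    + frag_cmul ((-1) ^ card {x \<in> {a, b, c}. x < c}) (frag_of ({a, b, c} - {c})))"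
    using assms by (simp add: simplex_bd_def)
  then show ?thesis unfolding eqs using assms by simp
qed

lemma simplex_edgeE:
  assumes "S \<in> basis (simplex_adc n)" "deg (simplex_adc n) S = 1"
  obtains a b where "a < b" "b \<le> n" "S = {a, b}"
proof -
  have "card S = 2" "S \<subseteq> {0..n}" using assms by (auto simp: simplex_adc_def)
  then obtain a b where "S = {a, b}" "a < b"
    by (metis card_2_iff insert_commute linorder_neqE_nat)
  then show ?thesis using that \<open>S \<subseteq> {0..n}\<close> by auto
qed

lemma simplex_triangleE:
  assumes "S \<in> basis (simplex_adc n)" "deg (simplex_adc n) S = 2"
  obtains a b c where "a < b" "b < c" "S = {a, b, c}"
proof -
  have S: "card S = 3" using assms by (auto simp: simplex_adc_def)
  then have "finite S" by (simp add: card_ge_0_finite)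
  define vs where "vs = sorted_list_of_set S"
  have "length vs = 3" using S by (simp add: vs_def)
  then obtain a b c where "vs = [a, b, c]" by (auto simp: numeral_3_eq_3 length_Suc_conv)
  then have abc: "sorted_list_of_set S = [a, b, c]" by (simp add: vs_def)
  have "sorted_wrt (<) [a, b, c]" by (metis abc strict_sorted_list_of_set)
  moreover have "S = {a, b, c}"
    using \<open>finite S\<close> abc by (metis set_sorted_list_of_set list.set(1,2))
  ultimately show ?thesis using that[of a b c] by simp
qed

interpretation simplex: graph_like_complex "simplex_adc n" "\<lambda>S. int (Min S)" for n
proof (intro graph_like_complex.intro graph_like_complex_axioms.intro)
  fix S assume "S \<in> basis (simplex_adc n)" "deg (simplex_adc n) S = 1"
  then obtain a b where "a < b" "b \<le> n" "S = {a, b}" by (rule simplex_edgeE)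
  then show "\<exists>A B. A \<in> basis (simplex_adc n) \<and> deg (simplex_adc n) A = 0 \<and>
      B \<in> basis (simplex_adc n) \<and> deg (simplex_adc n) B = 0 \<and>
      bd (simplex_adc n) S = frag_of B - frag_of A \<and> int (Min A) < int (Min B)"
    by (intro exI[of _ "{a}"] exI[of _ "{b}"]) (simp add: simplex_adc_def simplex_bd_edge)
qed (simp_all add: augmented_directed_complex_simplex, simp add: simplex_adc_def)

lemma simplex_vertices: "simplex.vertices n = (\<lambda>i. {i}) ` {..n}"
proof
  show "simplex.vertices n \<subseteq> (\<lambda>i. {i}) ` {..n}"
  proof
    fix S assume "S \<in> simplex.vertices n"
    then have S: "S \<noteq> {}" "S \<subseteq> {0..n}" "card S \<le> 1"
      unfolding simplex.vertices_def by (auto simp: simplex_adc_def)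
    then have "finite S" by (auto intro: finite_subset)
    then obtain i where "S = {i}"
      using S by (metis card_0_eq card_1_singletonE le_antisym less_one linorder_not_le)
    then show "S \<in> (\<lambda>i. {i}) ` {..n}" using S by auto
  qed
next
  show "(\<lambda>i. {i}) ` {..n} \<subseteq> simplex.vertices n"
    unfolding simplex.vertices_def by (auto simp: simplex_adc_def)
qed

text \<open>
  Edges lead from smaller to larger vertices, so a path is determined by the set of vertices that it
  visits: it visits them in increasing order.
\<close>

definition simplex_chain :: "nat set \<Rightarrow> (nat set \<Rightarrow>\<^sub>0 int)" where
  "simplex_chain V = path_chain (\<lambda>v w. {v, w}) (sorted_list_of_set V)"

lemma sorted_list_of_set_insert_Min:
  fixes i :: nat
  assumes "finite V" "\<forall>v\<in>V. i < v"
  shows "sorted_list_of_set (insert i V) = i # sorted_list_of_set V"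
proof -
  have "Min (insert i V) = i" using assms by (intro Min_eqI) (auto intro: less_imp_le)
  moreover have "insert i V - {i} = V" using assms(2) by auto
  ultimately show ?thesis using sorted_list_of_set_nonempty[of "insert i V"] assms(1) by simp
qed

lemma simplex_chain_singleton [simp]: "simplex_chain {i} = 0"
  by (simp add: simplex_chain_def)

lemma simplex_chain_insert_Min:
  assumes "finite V" "V \<noteq> {}" "\<forall>v\<in>V. i < v"
  shows "simplex_chain (insert i V) = frag_of {i, Min V} + simplex_chain V"
  unfolding simplex_chain_def sorted_list_of_set_insert_Min[OF assms(1,3)]
  using sorted_list_of_set_nonempty[OF assms(1,2)] by simp

lemma Min_insert_less:
  fixes i :: nat
  assumes "finite V" "\<forall>v\<in>V. i < v"
  shows "Min (insert i V) = i"
  using assms by (intro Min_eqI) (auto intro: less_imp_le)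

lemma Max_insert_less:
  fixes i :: nat
  assumes "finite V" "V \<noteq> {}" "\<forall>v\<in>V. i < v"
  shows "Max (insert i V) = Max V"
  using assms by (simp add: max_def) (meson Max_in less_le_not_le)

lemma simplex_walk_iff:
  "simplex.walk n a b p \<longleftrightarrow>
     (\<exists>V. V \<noteq> {} \<and> V \<subseteq> {..n} \<and> a = {Min V} \<and> b = {Max V} \<and> p = simplex_chain V)"
proof
  assume "simplex.walk n a b p"
  then show "\<exists>V. V \<noteq> {} \<and> V \<subseteq> {..n} \<and> a = {Min V} \<and> b = {Max V} \<and> p = simplex_chain V"
  proof (induction rule: simplex.walk.induct)
    case (walk_refl a)
    then obtain i where "a = {i}" "i \<le> n" by (auto simp: simplex_vertices)
    then show ?case by (intro exI[of _ "{i}"]) simp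
  next
    case (walk_step e a a' b p)
    then obtain V where V: "V \<noteq> {}" "V \<subseteq> {..n}" "a' = {Min V}" "b = {Max V}" "p = simplex_chain V"
      by blast
    obtain u v where uv: "u < v" "v \<le> n" "e = {u, v}"
      using walk_step.hyps(1,2) by (rule simplex_edgeE)
    have eq: "frag_of {v} - frag_of {u} = frag_of a' - frag_of a"
      using walk_step.hyps(5) uv by (simp add: simplex_adc_def simplex_bd_edge)
    then have "{u} = a" "{v} = a'" using frag_of_diff_eqD[OF eq] uv(1) by auto
    then have uv': "a = {u}" "v = Min V" using V(3) by auto
    have fin: "finite V" using V(2) finite_subset by blast
    have less: "\<forall>w\<in>V. u < w" using uv(1) uv'(2) fin by (simp add: Min_gr_iff[OF fin V(1)])
    have "frag_of e + p = simplex_chain (insert u V)"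
      using simplex_chain_insert_Min[OF fin V(1) less] uv uv' V(5) by simp
    then show ?case
      using V uv uv' Min_insert_less[OF fin less] Max_insert_less[OF fin V(1) less]
      by (intro exI[of _ "insert u V"]) auto
  qed
next
  assume "\<exists>V. V \<noteq> {} \<and> V \<subseteq> {..n} \<and> a = {Min V} \<and> b = {Max V} \<and> p = simplex_chain V"
  then obtain V where V: "V \<noteq> {}" "V \<subseteq> {..n}" "a = {Min V}" "b = {Max V}" "p = simplex_chain V"
    by blast
  have "finite V" using V(2) finite_subset by blast
  then have "simplex.walk n {Min V} {Max V} (simplex_chain V)" using V(1,2)
  proof (induction rule: finite_linorder_min_induct)
    case (insert i V)
    show ?case
    proof (cases "V = {}")
      case True
      then show ?thesis
        using insert.prems by (auto intro!: simplex.walk_refl simp: simplex_vertices)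
    next
      case False
      have less: "\<forall>v\<in>V. i < v" using insert.hyps(2) by blast
      have "Min V \<in> V" using insert.hyps(1) False by simp
      then have "i < Min V" "Min V \<le> n" using less insert.prems by auto
      have "simplex.walk n {i} {Max V} (frag_of {i, Min V} + simplex_chain V)"
      proof (rule simplex.walk_step)
        show "simplex.walk n {Min V} {Max V} (simplex_chain V)"
          using insert.IH False insert.prems by simp
        show "{i} \<in> simplex.vertices n" "{Min V} \<in> simplex.vertices n"
          using \<open>i < Min V\<close> \<open>Min V \<le> n\<close> by (auto simp: simplex_vertices)
      qed (use \<open>i < Min V\<close> \<open>Min V \<le> n\<close> in \<open>auto simp: simplex_adc_def simplex_bd_edge\<close>)
      then show ?thesis
        unfolding simplex_chain_insert_Min[OF insert.hyps(1) False less]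
          Min_insert_less[OF insert.hyps(1) less] Max_insert_less[OF insert.hyps(1) False less] .
    qed
  qed simp
  then show "simplex.walk n a b p" using V by simp
qed

text \<open>
  The functional is the out-degree of \<open>v\<close>: every visited vertex except the last one has one
  outgoing edge.
\<close>

lemma pairing_simplex_chain:
  assumes "finite V" "V \<noteq> {}"
  shows "pairing (\<lambda>S. of_bool (Min S = v)) (simplex_chain V) = of_bool (v \<in> V \<and> v \<noteq> Max V)"
  using assms
proof (induction rule: finite_linorder_min_induct)
  case (insert i V)
  show ?case
  proof (cases "V = {}")
    case False
    note less = insert.hyps(2)
    have "Min V \<in> V" "Max V \<in> V" using insert.hyps(1) False by simp_all
    then have "i < Min V" "i < Max V" using less by auto
    then show ?thesis
      using insert.IH[OF False] less
      unfolding simplex_chain_insert_Min[OF insert.hyps(1) False less]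
        Max_insert_less[OF insert.hyps(1) False less]
      by auto
  qed simp
qed simp

text \<open>
  The triangle \<open>{a < x < b}\<close> has the edge from \<open>a\<close> to \<open>b\<close> as its source and the path through \<open>x\<close>
  as its target, so adding its boundary inserts \<open>x\<close> between its neighbours \<open>a\<close> and \<open>b\<close> in \<open>V\<close>.
\<close>

lemma simplex_chain_insert:
  assumes "finite V" "\<exists>u\<in>V. u < x" "\<exists>w\<in>V. x < w" "x \<notin> V"
  shows "\<exists>a b. a \<in> V \<and> b \<in> V \<and> a < x \<and> x < b \<and>
           simplex_chain (insert x V) = simplex_chain V + simplex_bd {a, x, b}"
  using assms
proof (induction rule: finite_linorder_min_induct)
  case (insert i V)
  note less = insert.hyps(2)
  have "i < x" using insert.prems(1) less by force
  then have ne: "V \<noteq> {}" and ex: "\<exists>w\<in>V. x < w" and "x \<notin> V" using insert.prems by auto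
  have less': "\<forall>w\<in>insert x V. i < w" using less \<open>i < x\<close> by auto
  have chain: "simplex_chain (insert x (insert i V)) =
      frag_of {i, Min (insert x V)} + simplex_chain (insert x V)"
    using simplex_chain_insert_Min[of "insert x V" i] less' insert.hyps(1)
    by (simp add: insert_commute)
  note chain' = simplex_chain_insert_Min[OF insert.hyps(1) ne less]
  show ?case
  proof (cases "\<exists>u\<in>V. u < x")
    case True
    then have "Min V < x" using insert.hyps(1) ne by (simp add: Min_less_iff)
    then have "Min (insert x V) = Min V" using insert.hyps(1) ne by simp
    then show ?thesis using insert.IH[OF True ex \<open>x \<notin> V\<close>] chain chain' by (auto simp: add.assoc)
  next
    case False
    then have gt: "\<forall>w\<in>V. x < w" using \<open>x \<notin> V\<close> by (metis linorder_neqE_nat)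
    have "Min V \<in> V" using insert.hyps(1) ne by simp
    then have "x < Min V" using gt by blast
    have "simplex_chain (insert x V) = frag_of {x, Min V} + simplex_chain V"
      using simplex_chain_insert_Min[OF insert.hyps(1) ne gt] .
    then have "simplex_chain (insert x (insert i V)) =
        simplex_chain (insert i V) + simplex_bd {i, x, Min V}"
      using chain chain' Min_insert_less[OF insert.hyps(1) gt]
        simplex_bd_triangle[OF \<open>i < x\<close> \<open>x < Min V\<close>] by simp
    then show ?thesis using \<open>Min V \<in> V\<close> \<open>i < x\<close> \<open>x < Min V\<close> by blast
  qed
qed simp

lemma bounds_le_simplex_chain_Un:
  assumes "finite V" "V \<subseteq> {..n}" "i \<in> V" "j \<in> V" "finite C" "C \<subseteq> {i<..<j}"
  shows "bounds_le (simplex_adc n) (simplex_chain V) (simplex_chain (C \<union> V))"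
  using assms(5,6)
proof (induction rule: finite_induct)
  case (insert x C)
  have "j \<le> n" using assms(2,4) by auto
  have "bounds_le (simplex_adc n) (simplex_chain (C \<union> V)) (simplex_chain (insert x (C \<union> V)))"
  proof (cases "x \<in> V")
    case True
    then have "insert x (C \<union> V) = C \<union> V" by auto
    then show ?thesis by simp
  next
    case False
    obtain a b where ab: "a \<in> C \<union> V" "b \<in> C \<union> V" "a < x" "x < b" "simplex_chain (insert x (C \<union> V)) =
        simplex_chain (C \<union> V) + simplex_bd {a, x, b}"
      using simplex_chain_insert[of "C \<union> V" x] False assms(1,3,4) insert by auto
    have "b \<le> n" using ab(2) assms(2) insert.prems \<open>j \<le> n\<close> by auto
    then show ?thesis
      using ab(3-5) by (intro bounds_le_bd[of "{a, x, b}"]) (auto simp: simplex_adc_def)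
  qed
  then show ?case using insert bounds_le_trans by force
qed simp

lemma Min_Max_insert_between:
  fixes i j :: nat
  assumes "A \<subseteq> {i<..<j}" "i < j"
  shows "finite ({i} \<union> A \<union> {j})" "Min ({i} \<union> A \<union> {j}) = i" "Max ({i} \<union> A \<union> {j}) = j"
proof -
  show fin: "finite ({i} \<union> A \<union> {j})" using assms(1) finite_subset by auto
  show "Min ({i} \<union> A \<union> {j}) = i" by (rule Min_eqI[OF fin]) (use assms in auto)
  show "Max ({i} \<union> A \<union> {j}) = j" by (rule Max_eqI[OF fin]) (use assms in auto)
qed

text \<open>
  Vertices can be inserted one at a time.  Conversely, the boundary of a triangle has out-degree
  \<open>1\<close> at its middle vertex and \<open>0\<close> elsewhere, so that out-degrees do not decrease along 2-cells.
\<close>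

lemma bounds_le_simplex_chain_iff:
  assumes "i < j" "j \<le> n" "A \<subseteq> {i<..<j}" "B \<subseteq> {i<..<j}"
  shows "bounds_le (simplex_adc n) (simplex_chain ({i} \<union> A \<union> {j})) (simplex_chain ({i} \<union> B \<union> {j}))
           \<longleftrightarrow> A \<subseteq> B"
proof
  assume le: "bounds_le (simplex_adc n) (simplex_chain ({i} \<union> A \<union> {j})) (simplex_chain ({i} \<union> B \<union> {j}))"
  note fin = Min_Max_insert_between(1)[OF assms(3,1)] Min_Max_insert_between(1)[OF assms(4,1)]
    and Max = Min_Max_insert_between(3)[OF assms(3,1)] Min_Max_insert_between(3)[OF assms(4,1)]
  show "A \<subseteq> B"
  proof
    fix v assume "v \<in> A"
    have "0 \<le> pairing (\<lambda>S. of_bool (Min S = v)) (bd (simplex_adc n) S)"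
      if S: "S \<in> basis (simplex_adc n)" "deg (simplex_adc n) S = 2" for S
    proof -
      obtain a b c where "a < b" "b < c" "S = {a, b, c}" using S by (rule simplex_triangleE)
      then show ?thesis by (simp add: simplex_adc_def simplex_bd_triangle)
    qed
    from bounds_le_pairing_mono[OF le this] show "v \<in> B"
      using \<open>v \<in> A\<close> assms fin
      by (auto simp: pairing_simplex_chain Max simp del: Un_insert_left Un_insert_right split: if_splits)
  qed
next
  assume "A \<subseteq> B"
  then have eq: "{i} \<union> B \<union> {j} = B \<union> ({i} \<union> A \<union> {j})" by auto
  show "bounds_le (simplex_adc n) (simplex_chain ({i} \<union> A \<union> {j})) (simplex_chain ({i} \<union> B \<union> {j}))"
    unfolding eq by (rule bounds_le_simplex_chain_Un[where i = i and j = j])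
      (use assms in \<open>auto intro: finite_subset\<close>)
qed

lemma simplex_paths_iff:
  assumes "i \<le> n" "j \<le> n"
  shows "p \<in> simplex.paths n {i} {j} \<longleftrightarrow>
    (\<exists>V. V \<noteq> {} \<and> V \<subseteq> {..n} \<and> Min V = i \<and> Max V = j \<and> p = simplex_chain V)"
  using assms simplex.paths_eq_walks[of "{i}" n "{j}"] unfolding simplex_walk_iff
  by (auto simp: simplex_vertices)

theorem pi0_oriental:
  "poset_iso (chain_poset n) (pi0 (oriental n)) (\<lambda>i. pi0_class (oriental n) (simplex_vertex i))"
  unfolding oriental_def simplex_vertex_def
proof (rule poset_iso_pi0I[where A = "{..n}"])
  show "(\<lambda>i. nu_obj {i}) ` {..n} = objects (nu (simplex_adc n))"
    unfolding simplex.objects_nu simplex_vertices by auto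
next
  fix i j assume ij: "i \<in> {..n}" "j \<in> {..n}"
  have "simplex.paths n {i} {j} \<noteq> {} \<longleftrightarrow> i \<le> j"
  proof
    assume "simplex.paths n {i} {j} \<noteq> {}"
    then obtain V where "V \<noteq> {}" "V \<subseteq> {..n}" "Min V = i" "Max V = j"
      using ij simplex_paths_iff[of i n j] by auto
    then show "i \<le> j" by (metis Max_ge Min_in finite_atMost finite_subset)
  next
    assume "i \<le> j"
    then have "simplex_chain {i, j} \<in> simplex.paths n {i} {j}"
      using ij by (subst simplex_paths_iff) (auto intro!: exI[of _ "{i, j}"])
    then show "simplex.paths n {i} {j} \<noteq> {}" by blast
  qed
  then show "(i, j) \<in> chain_poset n \<longleftrightarrow> (nu_obj {i}, nu_obj {j}) \<in> mor_rel (nu (simplex_adc n))"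
    using simplex.mor_rel_nu_iff[of "{i}" n "{j}"] ij
    by (auto simp: simplex_vertices chain_poset_def)
qed (auto simp: strict_omega_category_nu chain_poset_def antisym_def)

theorem pi1_oriental:
  assumes "i < j" "j \<le> n"
  shows "poset_iso (subset_poset {i + 1..j - 1})
         (pi1 (oriental n) (simplex_vertex i) (simplex_vertex j))
         (\<lambda>A. pi1_class (oriental n) (simplex_vertex i) (simplex_vertex j) (simplex_path n i j A))"
  unfolding oriental_def simplex_vertex_def
proof (rule simplex.poset_iso_pi1I[where A = "Pow {i + 1..j - 1}"
      and f = "\<lambda>A. simplex_chain ({i} \<union> A \<union> {j})"])
  have int: "{i + 1..j - 1} = {i<..<j}" by auto
  note ends = Min_Max_insert_between[OF _ assms(1)]
  show "{i} \<in> simplex.vertices n" "{j} \<in> simplex.vertices n"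
    using assms by (auto simp: simplex_vertices)
  show "(\<lambda>A. simplex_chain ({i} \<union> A \<union> {j})) ` Pow {i + 1..j - 1} = simplex.paths n {i} {j}"
    unfolding int
  proof (intro set_eqI iffI)
    fix p assume "p \<in> (\<lambda>A. simplex_chain ({i} \<union> A \<union> {j})) ` Pow {i<..<j}"
    then obtain A where A: "A \<subseteq> {i<..<j}" "p = simplex_chain ({i} \<union> A \<union> {j})" by blast
    then show "p \<in> simplex.paths n {i} {j}"
      using assms ends[OF A(1)] by (subst simplex_paths_iff) (auto intro!: exI[of _ "{i} \<union> A \<union> {j}"])
  next
    fix p assume "p \<in> simplex.paths n {i} {j}"
    then obtain V where V: "V \<noteq> {}" "V \<subseteq> {..n}" "Min V = i" "Max V = j" "p = simplex_chain V"
      using assms simplex_paths_iff[of i n j] by auto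
    have fin: "finite V" using V(2) finite_subset by blast
    have "i \<in> V" "j \<in> V" using V fin Min_in[of V] Max_in[of V] by auto
    moreover have "V \<subseteq> {i..j}" using V fin by auto
    ultimately have "V = {i} \<union> (V \<inter> {i<..<j}) \<union> {j}" by (auto simp: order_less_le)
    then show "p \<in> (\<lambda>A. simplex_chain ({i} \<union> A \<union> {j})) ` Pow {i<..<j}"
      using V(5) by (intro image_eqI[of _ _ "V \<inter> {i<..<j}"]) auto
  qed
  show "(A, B) \<in> subset_poset {i + 1..j - 1} \<longleftrightarrow> bounds_le (simplex_adc n)
      (simplex_chain ({i} \<union> A \<union> {j})) (simplex_chain ({i} \<union> B \<union> {j}))"
    if "A \<in> Pow {i + 1..j - 1}" "B \<in> Pow {i + 1..j - 1}" for A B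
    using that bounds_le_simplex_chain_iff[OF assms, of A B] unfolding int
    by (auto simp: subset_poset_def)
  show "simplex_path n i j A = path_table {i} {j} (simplex_chain ({i} \<union> A \<union> {j}))"
    if "A \<in> Pow {i + 1..j - 1}" for A
  proof -
    let ?V = "{i} \<union> A \<union> {j}" and ?vs = "sorted_list_of_set ({i} \<union> A \<union> {j})"
    have A: "A \<subseteq> {i<..<j}" using that unfolding int by simp
    have fin: "finite ?V" by (rule ends(1)[OF A])
    then have "?vs \<noteq> []" by simp
    have "hd ?vs = i"
      using sorted_list_of_set_nonempty[OF fin] ends(2)[OF A] by simp
    moreover have "last ?vs = j"
    proof (rule antisym)
      have "last ?vs \<in> ?V" using \<open>?vs \<noteq> []\<close> fin by (metis last_in_set set_sorted_list_of_set)
      then show "last ?vs \<le> j" using A assms by auto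
      have "j \<in> set ?vs" unfolding set_sorted_list_of_set[OF fin] by simp
      moreover have "sorted (butlast ?vs @ [last ?vs])" "set ?vs = set (butlast ?vs @ [last ?vs])"
        unfolding append_butlast_last_id[OF \<open>?vs \<noteq> []\<close>] by (rule sorted_sorted_list_of_set refl)+
      ultimately show "j \<le> last ?vs" by (auto simp only: sorted_append set_append list.set)
    qed
    moreover have "simplex_path n i j A =
        path_comp (nu (simplex_adc n)) (\<lambda>v. nu_obj {v}) (\<lambda>v w. nu_arr {v} {w} {v, w}) ?vs"
      unfolding simplex_path_def oriental_def simplex_vertex_def[abs_def] simplex_edge_def[abs_def] ..
    ultimately show ?thesis
      using path_comp_eq_path_table[OF \<open>?vs \<noteq> []\<close>, of "simplex_adc n" "\<lambda>v. {v}" "\<lambda>v w. {v, w}"]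
      by (simp only: simplex_chain_def)
  qed
qed (auto simp: subset_poset_def antisym_def)

lemma bool_power_poset_iso_subset_poset:
  "poset_iso (bool_power_poset (j - i - 1)) (subset_poset {i + 1..j - 1})
     (\<lambda>\<delta>. {k \<in> {i + 1..j - 1}. \<delta> ! (k - (i + 1))})"
proof -
  let ?m = "j - i - 1" and ?I = "{i + 1..j - 1}"
  let ?f = "\<lambda>\<delta>. {k \<in> ?I. \<delta> ! (k - (i + 1))}"
  have list: "list_all2 (\<le>) \<delta> \<delta>" "list_all2 (\<le>) \<delta> \<epsilon> \<Longrightarrow> list_all2 (\<le>) \<epsilon> \<delta> \<Longrightarrow> \<delta> = \<epsilon>"
    "list_all2 (\<le>) \<delta> \<epsilon> \<Longrightarrow> list_all2 (\<le>) \<epsilon> \<eta> \<Longrightarrow> list_all2 (\<le>) \<delta> \<eta>" for \<delta> \<epsilon> \<eta> :: "bool list"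
    by (auto simp: list_all2_conv_all_nth intro!: nth_equalityI)
  have Field: "Field (bool_power_poset ?m) = bool_power ?m" "Field (subset_poset ?I) = Pow ?I"
    using list(1) by (auto simp: Field_def bool_power_poset_def subset_poset_def)
  have le: "list_all2 (\<le>) \<delta> \<epsilon> \<longleftrightarrow> ?f \<delta> \<subseteq> ?f \<epsilon>" if "length \<delta> = ?m" "length \<epsilon> = ?m" for \<delta> \<epsilon>
  proof
    assume sub: "?f \<delta> \<subseteq> ?f \<epsilon>"
    have "\<delta> ! k \<le> \<epsilon> ! k" if "k < ?m" for k
    proof -
      have "k + (i + 1) \<in> ?I" using that by auto
      then have "k + (i + 1) \<in> ?f \<eta> \<longleftrightarrow> \<eta> ! k" for \<eta> by (simp add: add.commute)
      then show ?thesis using subsetD[OF sub, of "k + (i + 1)"] by (simp add: le_bool_def)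
    qed
    then show "list_all2 (\<le>) \<delta> \<epsilon>" using that by (simp add: list_all2_conv_all_nth)
  qed (use that in \<open>auto simp: list_all2_conv_all_nth\<close>)
  have "bij_betw ?f (bool_power ?m) (Pow ?I)"
    unfolding bij_betw_def
  proof
    show "inj_on ?f (bool_power ?m)"
      using le list(2) by (auto simp: inj_on_def bool_power_def)
    show "?f ` bool_power ?m = Pow ?I"
    proof
      show "Pow ?I \<subseteq> ?f ` bool_power ?m"
      proof
        fix A assume A: "A \<in> Pow ?I"
        \<comment> \<open>the preimage of a subset lists the truth values of membership along the interval\<close>
        let ?\<delta> = "map (\<lambda>k. k \<in> A) [i + 1..<j]"
        have nth: "?\<delta> ! (k - (i + 1)) \<longleftrightarrow> k \<in> A" if "k \<in> ?I" for k using that by auto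
        have "A = ?f ?\<delta>" using A nth by auto
        moreover have "?\<delta> \<in> bool_power ?m" by (simp add: bool_power_def)
        ultimately show "A \<in> ?f ` bool_power ?m" by blast
      qed
    qed auto
  qed
  then have "iso (bool_power_poset ?m) (subset_poset ?I) ?f"
    unfolding iso_iff2 Field using le
    by (auto simp: bool_power_poset_def subset_poset_def bool_power_def)
  moreover have "Partial_order (bool_power_poset ?m)"
    unfolding partial_order_on_def preorder_on_def refl_on_def trans_def antisym_def Field
    using list by (auto simp: bool_power_poset_def dest: list(2) list(3))
  moreover have "Partial_order (subset_poset ?I)"
    unfolding partial_order_on_def preorder_on_def refl_on_def trans_def antisym_def Field
    by (auto simp: subset_poset_def)
  ultimately show ?thesis by (simp add: poset_iso_def)
qed


section \<open>Oriented cubes\<close>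

lemma inv_Cons_pair: "inv (\<lambda>(x, xs). x # xs) (x # xs) = (x, xs)"
  using inv_f_f[OF inj_Cons_pair, of "(x, xs)"] by simp

lemma basis_cube: "basis (adc_power arrow_adc n) = {xs. length xs = n}"
proof (induction n)
  case (Suc n)
  then show ?case
    by (auto simp: adc_image_def adc_tensor_def arrow_adc_def length_Suc_conv image_iff)
qed (auto simp: adc_unit_def)

lemma deg_cube: "length xs = n \<Longrightarrow> deg (adc_power arrow_adc n) xs = count_list xs Arr"
proof (induction n arbitrary: xs)
  case (Suc n)
  then obtain y ys where xs: "xs = y # ys" "length ys = n" by (auto simp: length_Suc_conv)
  then show ?case
    using Suc.IH[of ys] by (cases y) (simp_all add: adc_image_def adc_tensor_def inv_Cons_pair arrow_adc_def)
qed (simp add: adc_unit_def)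

lemma aug_cube: "length xs = n \<Longrightarrow> aug (adc_power arrow_adc n) xs = 1"
proof (induction n arbitrary: xs)
  case (Suc n)
  then obtain y ys where xs: "xs = y # ys" "length ys = n" by (auto simp: length_Suc_conv)
  then show ?case
    using Suc.IH[of ys] by (simp add: adc_image_def adc_tensor_def inv_Cons_pair arrow_adc_def)
qed (simp add: adc_unit_def)

lemma frag_extend_Cons_tensor:
  "frag_extend (\<lambda>a. frag_of (case a of (x, xs) \<Rightarrow> x # xs)) (chain_tensor (frag_of x) c) =
     frag_extend (\<lambda>xs. frag_of (x # xs)) c"
proof -
  have "Poly_Mapping.keys c \<subseteq> UNIV" by simp
  then show ?thesis
    by (induction c rule: frag_induction)
      (simp_all add: chain_tensor_diff_right frag_extend_diff)
qed

lemma bd_cube_Pt: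
  "bd (adc_power arrow_adc (Suc n)) (Pt v # xs) =
     frag_extend (\<lambda>xs. frag_of (Pt v # xs)) (bd (adc_power arrow_adc n) xs)"
  by (simp add: adc_image_def adc_tensor_def inv_Cons_pair frag_extend_Cons_tensor)
    (simp add: arrow_adc_def frag_extend_Cons_tensor)

text \<open>
  The sign of the last term is the sign \<open>(-1) ^ deg Arr\<close> in the boundary of a tensor product.
\<close>

lemma bd_cube_Arr:
  "bd (adc_power arrow_adc (Suc n)) (Arr # xs) =
     frag_of (Pt True # xs) - frag_of (Pt False # xs)
       - frag_extend (\<lambda>xs. frag_of (Arr # xs)) (bd (adc_power arrow_adc n) xs)"
  by (simp add: adc_image_def adc_tensor_def inv_Cons_pair)
    (simp add: arrow_adc_def frag_extend_Cons_tensor chain_tensor_diff_left frag_extend_diff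
      frag_extend_minus)

lemma bd_cube_vertex: "length \<delta> = n \<Longrightarrow> bd (adc_power arrow_adc n) (map Pt \<delta>) = 0"
proof (induction \<delta> arbitrary: n)
  case (Cons v \<delta>)
  then show ?case by (cases n) (simp_all add: bd_cube_Pt del: adc_power.simps(2))
qed (simp add: adc_unit_def)

lemma bd_cube_edge:
  assumes "length \<delta> = n" "k < n"
  shows "bd (adc_power arrow_adc n) ((map Pt \<delta>)[k := Arr]) =
           frag_of (map Pt (\<delta>[k := True])) - frag_of (map Pt (\<delta>[k := False]))"
  using assms
proof (induction \<delta> arbitrary: n k)
  case (Cons v \<delta>)
  then show ?case
    by (cases n; cases k)
      (simp_all add: bd_cube_Pt bd_cube_Arr bd_cube_vertex frag_extend_diff del: adc_power.simps(2))
qed simp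

text \<open>
  The faces in direction \<open>k\<close> have the signs of an edge, those in direction \<open>l\<close> the opposite ones,
  because one coordinate of degree \<open>1\<close> precedes \<open>l\<close>.  The positive and the negative part are the two
  paths around the square.
\<close>

lemma bd_cube_square:
  assumes "length \<delta> = n" "k < l" "l < n"
  shows "bd (adc_power arrow_adc n) ((map Pt \<delta>)[k := Arr, l := Arr]) =
           (frag_of ((map Pt (\<delta>[k := True]))[l := Arr]) + frag_of ((map Pt (\<delta>[l := False]))[k := Arr]))
         - (frag_of ((map Pt (\<delta>[l := True]))[k := Arr]) + frag_of ((map Pt (\<delta>[k := False]))[l := Arr]))"
  using assms
proof (induction \<delta> arbitrary: n k l)
  case (Cons v \<delta>)
  obtain m l' where ml: "n = Suc m" "l = Suc l'" "l' < m" "length \<delta> = m"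
    using Cons.prems by (cases n; cases l) auto
  show ?case
  proof (cases k)
    case 0
    then show ?thesis
      using ml by (simp add: bd_cube_Arr bd_cube_edge frag_extend_diff del: adc_power.simps(2))
  next
    case (Suc k')
    then show ?thesis
      using ml Cons by (simp add: bd_cube_Pt frag_extend_diff frag_extend_add del: adc_power.simps(2))
  qed
qed simp

lemma no_Arr_imp_map_Pt: "count_list xs Arr = 0 \<Longrightarrow> \<exists>\<delta>. xs = map Pt \<delta>"
proof (induction xs)
  case (Cons x xs)
  then obtain v \<delta> where "x = Pt v" "xs = map Pt \<delta>" by (cases x) auto
  then show ?case by (intro exI[of _ "v # \<delta>"]) simp
qed simp

lemma one_Arr_imp_edge:
  "count_list xs Arr = 1 \<Longrightarrow> \<exists>\<delta> k. k < length \<delta> \<and> xs = (map Pt \<delta>)[k := Arr]"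
proof (induction xs)
  case (Cons x xs)
  show ?case
  proof (cases x)
    case (Pt v)
    then obtain \<delta> k where "k < length \<delta>" "xs = (map Pt \<delta>)[k := Arr]" using Cons by auto
    then show ?thesis using Pt by (intro exI[of _ "v # \<delta>"] exI[of _ "Suc k"]) simp
  next
    case Arr
    then obtain \<delta> where "xs = map Pt \<delta>" using Cons.prems no_Arr_imp_map_Pt[of xs] by auto
    then show ?thesis using Arr by (intro exI[of _ "False # \<delta>"] exI[of _ 0]) simp
  qed
qed simp

lemma two_Arr_imp_square:
  "count_list xs Arr = 2 \<Longrightarrow> \<exists>\<delta> k l. k < l \<and> l < length \<delta> \<and> xs = (map Pt \<delta>)[k := Arr, l := Arr]"
proof (induction xs)
  case (Cons x xs)
  show ?case
  proof (cases x)
    case (Pt v)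
    then obtain \<delta> k l where "k < l" "l < length \<delta>" "xs = (map Pt \<delta>)[k := Arr, l := Arr]"
      using Cons by auto
    then show ?thesis
      using Pt by (intro exI[of _ "v # \<delta>"] exI[of _ "Suc k"] exI[of _ "Suc l"]) simp
  next
    case Arr
    then obtain \<delta> l where "l < length \<delta>" "xs = (map Pt \<delta>)[l := Arr]"
      using Cons.prems one_Arr_imp_edge[of xs] by auto
    then show ?thesis
      using Arr by (intro exI[of _ "False # \<delta>"] exI[of _ 0] exI[of _ "Suc l"]) simp
  qed
qed simp

lemma count_list_update_True:
  "k < length \<delta> \<Longrightarrow> count_list (map Pt (\<delta>[k := True])) (Pt True) =
     Suc (count_list (map Pt (\<delta>[k := False])) (Pt True))"
proof (induction \<delta> arbitrary: k)
  case (Cons v \<delta>)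
  then show ?case by (cases k) simp_all
qed simp

lemma cube_edgeE:
  assumes "e \<in> basis (adc_power arrow_adc n)" "deg (adc_power arrow_adc n) e = 1"
  obtains \<delta> k where "length \<delta> = n" "k < n" "e = (map Pt \<delta>)[k := Arr]"
proof -
  have "length e = n" using assms(1) by (simp add: basis_cube)
  then show ?thesis using one_Arr_imp_edge[of e] assms(2) that by (auto simp: deg_cube)
qed

lemma cube_squareE:
  assumes "e \<in> basis (adc_power arrow_adc n)" "deg (adc_power arrow_adc n) e = 2"
  obtains \<delta> k l where "length \<delta> = n" "k < l" "l < n" "e = (map Pt \<delta>)[k := Arr, l := Arr]"
proof -
  have "length e = n" using assms(1) by (simp add: basis_cube)
  then show ?thesis using two_Arr_imp_square[of e] assms(2) that by (auto simp: deg_cube)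
qed

lemma count_list_map_Pt [simp]: "count_list (map Pt \<delta>) Arr = 0"
  by (induction \<delta>) simp_all

lemma count_list_edge: "k < length \<delta> \<Longrightarrow> count_list ((map Pt \<delta>)[k := Arr]) Arr = 1"
  by (induction \<delta> arbitrary: k) (auto split: nat.split)

lemma count_list_square:
  "k < l \<Longrightarrow> l < length \<delta> \<Longrightarrow> count_list ((map Pt \<delta>)[k := Arr, l := Arr]) Arr = 2"
  by (induction \<delta> arbitrary: k l) (auto simp: count_list_edge split: nat.split)

lemma map_Pt_eq_iff [simp]: "map Pt \<delta> = map Pt \<epsilon> \<longleftrightarrow> \<delta> = \<epsilon>"
  by (rule inj_map_eq_map) (simp add: inj_def)

interpretation cube: graph_like_complex "adc_power arrow_adc n"
  "\<lambda>xs. int (count_list xs (Pt True))" for n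
proof (intro graph_like_complex.intro graph_like_complex_axioms.intro)
  fix e assume "e \<in> basis (adc_power arrow_adc n)" "deg (adc_power arrow_adc n) e = 1"
  then obtain \<delta> k where "length \<delta> = n" "k < n" "e = (map Pt \<delta>)[k := Arr]" by (rule cube_edgeE)
  then show "\<exists>a b. a \<in> basis (adc_power arrow_adc n) \<and> deg (adc_power arrow_adc n) a = 0 \<and>
      b \<in> basis (adc_power arrow_adc n) \<and> deg (adc_power arrow_adc n) b = 0 \<and>
      bd (adc_power arrow_adc n) e = frag_of b - frag_of a \<and>
      int (count_list a (Pt True)) < int (count_list b (Pt True))"
    by (intro exI[of _ "map Pt (\<delta>[k := False])"] exI[of _ "map Pt (\<delta>[k := True])"])
      (simp add: basis_cube deg_cube bd_cube_edge count_list_update_True)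
qed (simp_all add: augmented_directed_complex_cube basis_cube aug_cube)

lemma cube_vertices: "cube.vertices n = map Pt ` bool_power n"
proof
  show "cube.vertices n \<subseteq> map Pt ` bool_power n"
  proof
    fix xs assume "xs \<in> cube.vertices n"
    then have "length xs = n" "count_list xs Arr = 0"
      by (auto simp: cube.vertices_def basis_cube deg_cube)
    then show "xs \<in> map Pt ` bool_power n"
      using no_Arr_imp_map_Pt[of xs] by (auto simp: bool_power_def)
  qed
qed (auto simp: cube.vertices_def basis_cube deg_cube bool_power_def)

text \<open>A path that starts at \<open>\<delta>\<close>, recorded by the list of the directions of its edges.\<close>

fun cube_chain :: "bool list \<Rightarrow> nat list \<Rightarrow> (arrow_cell list \<Rightarrow>\<^sub>0 int)" where
  "cube_chain \<delta> [] = 0"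
| "cube_chain \<delta> (k # ks) = frag_of ((map Pt \<delta>)[k := Arr]) + cube_chain (flip_at k \<delta>) ks"

definition flip_orders :: "bool list \<Rightarrow> bool list \<Rightarrow> nat list set" where
  "flip_orders \<delta> \<epsilon> = {ks. distinct ks \<and> set ks = {k. k < length \<delta> \<and> \<delta> ! k \<noteq> \<epsilon> ! k}}"

lemma length_flip_at [simp]: "length (flip_at k \<delta>) = length \<delta>"
  by (simp add: flip_at_def)

lemma nth_flip_at: "k < length \<delta> \<Longrightarrow> flip_at k \<delta> ! i = (if i = k then \<not> \<delta> ! k else \<delta> ! i)"
  by (simp add: flip_at_def)

lemma flip_at_comm: "k \<noteq> l \<Longrightarrow> flip_at k (flip_at l \<delta>) = flip_at l (flip_at k \<delta>)"
  by (simp add: flip_at_def list_update_swap)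

lemma cube_chain_append:
  "cube_chain \<delta> (ks @ ls) = cube_chain \<delta> ks + cube_chain (fold flip_at ks \<delta>) ls"
  by (induction ks arbitrary: \<delta>) (simp_all add: add.assoc)

lemma length_fold_flip_at [simp]: "length (fold flip_at ks \<delta>) = length \<delta>"
  by (induction ks arbitrary: \<delta>) simp_all

lemma nth_fold_flip_at:
  assumes "distinct ks" "set ks \<subseteq> {..<length \<delta>}"
  shows "fold flip_at ks \<delta> ! i = (if i \<in> set ks then \<not> \<delta> ! i else \<delta> ! i)"
  using assms by (induction ks arbitrary: \<delta>) (auto simp: nth_flip_at)

lemma fold_flip_at_orders:
  assumes "ks \<in> flip_orders \<delta> \<epsilon>" "length \<epsilon> = length \<delta>"
  shows "fold flip_at ks \<delta> = \<epsilon>"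
proof (rule nth_equalityI)
  fix i assume "i < length (fold flip_at ks \<delta>)"
  then show "fold flip_at ks \<delta> ! i = \<epsilon> ! i"
    using assms(1) by (subst nth_fold_flip_at) (auto simp: flip_orders_def)
qed (simp add: assms)

lemma cube_edge_flip_at:
  assumes "k < length \<delta>"
  shows "map2 (\<lambda>a b. if a = b then Pt a else Arr) \<delta> (flip_at k \<delta>) = (map Pt \<delta>)[k := Arr]"
  using assms by (intro nth_equalityI) (auto simp: nth_flip_at nth_list_update)

lemma path_chain_flip_path:
  assumes "set ks \<subseteq> {..<length \<delta>}"
  shows "path_chain (\<lambda>\<delta> \<epsilon>. map2 (\<lambda>a b. if a = b then Pt a else Arr) \<delta> \<epsilon>) (flip_path \<delta> ks) =
           cube_chain \<delta> ks"
  using assms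
proof (induction ks arbitrary: \<delta>)
  case (Cons k ks)
  have "\<exists>ws. flip_path (flip_at k \<delta>) ks = flip_at k \<delta> # ws" by (cases ks) simp_all
  then show ?case using Cons.IH[of "flip_at k \<delta>"] Cons.prems by (auto simp: cube_edge_flip_at)
qed simp

lemma flip_path_ends:
  "flip_path \<delta> ks \<noteq> []" "hd (flip_path \<delta> ks) = \<delta>" "last (flip_path \<delta> ks) = fold flip_at ks \<delta>"
proof -
  have ne: "flip_path \<delta> ks \<noteq> []" for \<delta> ks by (cases ks) simp_all
  show "flip_path \<delta> ks \<noteq> []" by (rule ne)
  show "hd (flip_path \<delta> ks) = \<delta>" by (cases ks) simp_all
  show "last (flip_path \<delta> ks) = fold flip_at ks \<delta>"
    by (induction ks arbitrary: \<delta>) (simp_all add: ne)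
qed

text \<open>
  Every edge of the cube turns one coordinate from \<open>False\<close> to \<open>True\<close>, so a walk from \<open>\<delta>\<close> to \<open>\<epsilon>\<close>
  exists only for \<open>\<delta> \<le> \<epsilon>\<close> and then lists each differing coordinate once.
\<close>

lemma cube_walk_imp_flip_order:
  assumes "cube.walk n a b p"
  shows "length \<delta> = n \<Longrightarrow> a = map Pt \<delta> \<Longrightarrow> b = map Pt \<epsilon> \<Longrightarrow>
    list_all2 (\<le>) \<delta> \<epsilon> \<and> (\<exists>ks\<in>flip_orders \<delta> \<epsilon>. p = cube_chain \<delta> ks)"
  using assms
proof (induction arbitrary: \<delta> rule: cube.walk.induct)
  case (walk_refl a)
  then show ?case by (auto simp: list_all2_conv_all_nth flip_orders_def)
next
  case (walk_step e a a' b p)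
  obtain \<eta> k where \<eta>: "length \<eta> = n" "k < n" "e = (map Pt \<eta>)[k := Arr]"
    using walk_step.hyps(1,2) by (rule cube_edgeE)
  have "frag_of (map Pt (\<eta>[k := True])) - frag_of (map Pt (\<eta>[k := False])) = frag_of a' - frag_of a"
    using walk_step.hyps(5) bd_cube_edge[OF \<eta>(1,2)] \<eta>(3) by simp
  moreover have "\<eta>[k := False] \<noteq> \<eta>[k := True]" using \<eta>(1,2) by (metis nth_list_update_eq)
  ultimately have eqs: "map Pt (\<eta>[k := False]) = a" "map Pt (\<eta>[k := True]) = a'"
    using frag_of_diff_eqD by (metis map_Pt_eq_iff)+
  then have \<delta>: "\<delta> = \<eta>[k := False]" using walk_step.prems(2) by simp
  have flip: "flip_at k \<delta> = \<eta>[k := True]" using \<eta> by (simp add: \<delta> flip_at_def)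
  have e: "e = (map Pt \<delta>)[k := Arr]" by (simp add: \<eta>(3) \<delta> map_update)
  have "list_all2 (\<le>) (flip_at k \<delta>) \<epsilon> \<and> (\<exists>ks\<in>flip_orders (flip_at k \<delta>) \<epsilon>. p = cube_chain (flip_at k \<delta>) ks)"
    by (rule walk_step.IH) (use walk_step.prems eqs(2) flip \<eta>(1) in simp_all)
  then obtain ks where le: "list_all2 (\<le>) (flip_at k \<delta>) \<epsilon>"
    and ks: "ks \<in> flip_orders (flip_at k \<delta>) \<epsilon>" "p = cube_chain (flip_at k \<delta>) ks" by blast
  have k: "k < length \<delta>" "\<not> \<delta> ! k" using \<eta> by (simp_all add: \<delta>)
  have nth: "flip_at k \<delta> ! i \<le> \<epsilon> ! i" if "i < length \<delta>" for i
    using le that by (simp add: list_all2_conv_all_nth)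
  have "\<epsilon> ! k" using nth[of k] k by (simp add: nth_flip_at)
  have "\<delta> ! i \<le> \<epsilon> ! i" if "i < length \<delta>" for i
    using nth[OF that] k by (simp add: nth_flip_at le_bool_def split: if_splits)
  then have "list_all2 (\<le>) \<delta> \<epsilon>" using le by (simp add: list_all2_conv_all_nth)
  moreover have "k # ks \<in> flip_orders \<delta> \<epsilon>"
    using ks(1) k \<open>\<epsilon> ! k\<close> by (auto simp: flip_orders_def nth_flip_at split: if_splits)
  moreover have "frag_of e + p = cube_chain \<delta> (k # ks)" using ks(2) e by simp
  ultimately show ?case by blast
qed

lemma flip_order_imp_cube_walk:
  assumes "ks \<in> flip_orders \<delta> \<epsilon>" "list_all2 (\<le>) \<delta> \<epsilon>" "length \<delta> = n"
  shows "cube.walk n (map Pt \<delta>) (map Pt \<epsilon>) (cube_chain \<delta> ks)"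
  using assms
proof (induction ks arbitrary: \<delta>)
  case Nil
  then have "\<delta> = \<epsilon>" by (auto simp: flip_orders_def list_all2_conv_all_nth intro!: nth_equalityI)
  then show ?case using Nil by (auto simp: cube_vertices bool_power_def intro: cube.walk_refl)
next
  case (Cons k ks)
  have le: "length \<delta> = length \<epsilon>" "\<And>i. i < n \<Longrightarrow> \<delta> ! i \<le> \<epsilon> ! i"
    using Cons.prems by (auto simp: list_all2_conv_all_nth)
  have k: "k < n" "\<delta> ! k \<noteq> \<epsilon> ! k" "k \<notin> set ks" "distinct ks"
    "\<And>i. i = k \<or> i \<in> set ks \<longleftrightarrow> i < n \<and> \<delta> ! i \<noteq> \<epsilon> ! i"
    using Cons.prems by (auto simp: flip_orders_def)
  then have k': "\<not> \<delta> ! k" "\<epsilon> ! k" using le(2)[of k] by auto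
  have flip: "flip_at k \<delta> = \<delta>[k := True]" "\<delta> = \<delta>[k := False]"
    using k' by (simp_all add: flip_at_def) (metis list_update_id)
  have "cube.walk n (map Pt \<delta>) (map Pt \<epsilon>) (frag_of ((map Pt \<delta>)[k := Arr]) + cube_chain (flip_at k \<delta>) ks)"
  proof (rule cube.walk_step)
    show "cube.walk n (map Pt (flip_at k \<delta>)) (map Pt \<epsilon>) (cube_chain (flip_at k \<delta>) ks)"
    proof (rule Cons.IH)
      have "set ks = {i. i < n \<and> flip_at k \<delta> ! i \<noteq> \<epsilon> ! i}"
        using k k' Cons.prems(3) by (auto simp: nth_flip_at split: if_splits)
      then show "ks \<in> flip_orders (flip_at k \<delta>) \<epsilon>"
        using k(4) Cons.prems(3) by (simp add: flip_orders_def)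
      show "list_all2 (\<le>) (flip_at k \<delta>) \<epsilon>"
        using le k k' Cons.prems(3) by (auto simp: list_all2_conv_all_nth nth_flip_at)
    qed (simp add: Cons.prems)
    show "bd (adc_power arrow_adc n) ((map Pt \<delta>)[k := Arr]) =
        frag_of (map Pt (flip_at k \<delta>)) - frag_of (map Pt \<delta>)"
      using bd_cube_edge[OF Cons.prems(3) k(1)] flip by simp
    show "deg (adc_power arrow_adc n) ((map Pt \<delta>)[k := Arr]) = 1"
      using Cons.prems(3) k(1) by (simp add: deg_cube count_list_edge)
  qed (use Cons.prems in \<open>auto simp: basis_cube cube_vertices bool_power_def\<close>)
  then show ?case by simp
qed

lemma cube_paths_iff:
  assumes "length \<delta> = n" "length \<epsilon> = n"
  shows "p \<in> cube.paths n (map Pt \<delta>) (map Pt \<epsilon>) \<longleftrightarrow>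
           list_all2 (\<le>) \<delta> \<epsilon> \<and> p \<in> cube_chain \<delta> ` flip_orders \<delta> \<epsilon>"
  using cube.paths_eq_walks[of "map Pt \<delta>" n "map Pt \<epsilon>"] assms
    cube_walk_imp_flip_order[of n "map Pt \<delta>" "map Pt \<epsilon>" p \<delta> \<epsilon>]
    flip_order_imp_cube_walk[of _ \<delta> \<epsilon> n]
  by (auto simp: cube_vertices bool_power_def)

theorem pi0_cube:
  "poset_iso (bool_power_poset n) (pi0 (oriented_cube n))
     (\<lambda>\<delta>. pi0_class (oriented_cube n) (cube_vertex \<delta>))"
  unfolding oriented_cube_def cube_vertex_def
proof (rule poset_iso_pi0I[where A = "bool_power n"])
  show "(\<lambda>\<delta>. nu_obj (map Pt \<delta>)) ` bool_power n = objects (nu (adc_power arrow_adc n))"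
    unfolding cube.objects_nu cube_vertices by auto
  show "(\<delta>, \<epsilon>) \<in> bool_power_poset n \<longleftrightarrow>
      (nu_obj (map Pt \<delta>), nu_obj (map Pt \<epsilon>)) \<in> mor_rel (nu (adc_power arrow_adc n))"
    if "\<delta> \<in> bool_power n" "\<epsilon> \<in> bool_power n" for \<delta> \<epsilon>
  proof -
    have "filter (\<lambda>k. \<delta> ! k \<noteq> \<epsilon> ! k) [0..<length \<delta>] \<in> flip_orders \<delta> \<epsilon>"
      by (auto simp: flip_orders_def)
    then have "cube.paths n (map Pt \<delta>) (map Pt \<epsilon>) \<noteq> {} \<longleftrightarrow> list_all2 (\<le>) \<delta> \<epsilon>"
      using that cube_paths_iff[of \<delta> n \<epsilon>] by (auto simp: bool_power_def)
    then show ?thesis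
      using that cube.mor_rel_nu_iff[of "map Pt \<delta>" n "map Pt \<epsilon>"]
      by (simp add: cube_vertices bool_power_poset_def)
  qed
qed (auto simp: strict_omega_category_nu bool_power_poset_def antisym_def bool_power_def
    list_all2_conv_all_nth intro!: nth_equalityI)

text \<open>
  For \<open>k < l\<close> the generating square in directions \<open>k\<close> and \<open>l\<close> has the path that turns \<open>l\<close> first as
  its source and the path that turns \<open>k\<close> first as its target.
\<close>

lemma bounds_le_swap:
  assumes "k < l" "l < length \<delta>" "distinct (ks @ k # l # ls)" "set ks \<subseteq> {..<length \<delta>}"
    and "\<not> \<delta> ! k" "\<not> \<delta> ! l"
  shows "bounds_le (adc_power arrow_adc (length \<delta>))
           (cube_chain \<delta> (ks @ l # k # ls)) (cube_chain \<delta> (ks @ k # l # ls))"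
proof (rule bounds_le_bd)
  let ?n = "length \<delta>"
  define \<eta> where "\<eta> = fold flip_at ks \<delta>"
  have len: "length \<eta> = ?n" by (simp add: \<eta>_def)
  have \<eta>: "\<not> \<eta> ! k" "\<not> \<eta> ! l" using assms by (simp_all add: \<eta>_def nth_fold_flip_at)
  have upd: "\<eta>[k := False] = \<eta>" "\<eta>[l := False] = \<eta>" using \<eta> by (metis list_update_id)+
  let ?S = "(map Pt \<eta>)[k := Arr, l := Arr]"
  show "?S \<in> basis (adc_power arrow_adc ?n)" by (simp add: basis_cube len)
  show "deg (adc_power arrow_adc ?n) ?S = 2"
    using assms(1,2) len by (simp add: deg_cube count_list_square)
  have "flip_at k \<eta> = \<eta>[k := True]" "flip_at l \<eta> = \<eta>[l := True]"
    using \<eta> by (simp_all add: flip_at_def)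
  moreover have "flip_at l (flip_at k \<eta>) = flip_at k (flip_at l \<eta>)"
    using assms(1) by (simp add: flip_at_comm)
  ultimately show "cube_chain \<delta> (ks @ k # l # ls) =
      cube_chain \<delta> (ks @ l # k # ls) + bd (adc_power arrow_adc ?n) ?S"
    unfolding cube_chain_append \<eta>_def[symmetric] bd_cube_square[OF len assms(1,2)] upd
    by simp
qed

text \<open>
  Extended linearly, this counts the edges in direction \<open>l\<close> along which coordinate \<open>k\<close> is \<open>True\<close>.
\<close>

definition turned_before :: "nat \<Rightarrow> nat \<Rightarrow> arrow_cell list \<Rightarrow> int" where
  "turned_before k l xs = of_bool (xs ! l = Arr \<and> xs ! k = Pt True)"

lemma turned_before_edge:
  assumes "k \<noteq> l" "k < length \<delta>" "l < length \<delta>" "i < length \<delta>"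
  shows "turned_before k l ((map Pt \<delta>)[i := Arr]) = of_bool (l = i \<and> \<delta> ! k)"
  using assms by (auto simp: turned_before_def nth_list_update)

text \<open>
  In the square with directions \<open>k\<close> and \<open>l\<close> only the target turns \<open>k\<close> before \<open>l\<close>.  In a square with
  \<open>l\<close> and another direction, source and target contain one edge in direction \<open>l\<close> each, with the
  same coordinate \<open>k\<close>.
\<close>

lemma turned_before_square_nonneg:
  assumes "k < l" "l < n" "S \<in> basis (adc_power arrow_adc n)" "deg (adc_power arrow_adc n) S = 2"
  shows "0 \<le> pairing (turned_before k l) (bd (adc_power arrow_adc n) S)"
proof -
  obtain \<delta> i j where "length \<delta> = n" "i < j" "j < n" "S = (map Pt \<delta>)[i := Arr, j := Arr]"
    using assms(3,4) by (rule cube_squareE)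
  then show ?thesis
    using assms(1,2) by (simp add: bd_cube_square turned_before_edge nth_list_update)
qed

text \<open>
  There is one edge in direction \<open>l\<close>, and coordinate \<open>k\<close> is \<open>True\<close> along it if it was so from the
  beginning or was turned earlier.
\<close>

lemma pairing_turned_before:
  assumes "distinct ks" "set ks \<subseteq> {..<length \<delta>}" "k < length \<delta>" "l < length \<delta>" "k \<noteq> l"
    and "\<forall>i\<in>set ks. \<not> \<delta> ! i"
  shows "pairing (turned_before k l) (cube_chain \<delta> ks) =
           of_bool (l \<in> set ks \<and> (\<delta> ! k \<or> k \<in> set (takeWhile (\<lambda>i. i \<noteq> l) ks)))"
  using assms
proof (induction ks arbitrary: \<delta>)
  case (Cons i ks)
  have "\<forall>j\<in>set ks. \<not> flip_at i \<delta> ! j" using Cons.prems by (auto simp: nth_flip_at)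
  then have "pairing (turned_before k l) (cube_chain (flip_at i \<delta>) ks) = of_bool
      (l \<in> set ks \<and> (flip_at i \<delta> ! k \<or> k \<in> set (takeWhile (\<lambda>i. i \<noteq> l) ks)))"
    using Cons.prems by (intro Cons.IH) auto
  then show ?case using Cons.prems by (auto simp: turned_before_edge nth_flip_at)
qed simp


section \<open>The weak Bruhat order and inversions\<close>

text \<open>
  Inversions are pairs of values, not of positions: a step exchanges the contents of two adjacent
  positions, and it is the sets of inverted pairs of values that grow under such exchanges.
\<close>

definition inversions :: "nat \<Rightarrow> (nat \<Rightarrow> nat) \<Rightarrow> (nat \<times> nat) set" where
  "inversions m \<rho> = {(u, v). u \<in> {1..m} \<and> v \<in> {1..m} \<and> u < v \<and> inv \<rho> v < inv \<rho> u}"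

lemma permutes_adjacent_in:
  fixes \<rho> :: "nat \<Rightarrow> nat"
  assumes "\<rho> permutes {1..m}" "i \<in> {1..<m}"
  shows "\<rho> i \<in> {1..m}" "\<rho> (i + 1) \<in> {1..m}"
  using assms(2) by (simp_all only: permutes_in_image[OF assms(1)]) auto

lemma weak_bruhat_step_permutes:
  assumes "weak_bruhat_step m \<rho> \<sigma>" "\<rho> permutes {1..m}"
  shows "\<sigma> permutes {1..m}"
proof -
  obtain i where i: "i \<in> {1..<m}" "\<sigma> = transpose (\<rho> i) (\<rho> (i + 1)) \<circ> \<rho>"
    using assms(1) by (auto simp: weak_bruhat_step_def)
  note permutes_adjacent_in[OF assms(2) i(1)]
  then show ?thesis
    unfolding i(2) by (intro permutes_compose permutes_swap_id assms(2))
qed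

lemma transpose_values_eq:
  assumes "\<rho> permutes S"
  shows "transpose (\<rho> i) (\<rho> j) \<circ> \<rho> = \<rho> \<circ> transpose i j"
  using permutes_inj[OF assms] by (auto simp: fun_eq_iff transpose_def inj_eq)

text \<open>
  A step exchanges two adjacent positions that carry increasing values, and every other pair of
  values keeps its relative order.
\<close>

lemma inversions_step:
  assumes \<rho>: "\<rho> permutes {1..m}" and i: "i \<in> {1..<m}" "\<rho> i < \<rho> (i + 1)"
  shows "inversions m (transpose (\<rho> i) (\<rho> (i + 1)) \<circ> \<rho>) = insert (\<rho> i, \<rho> (i + 1)) (inversions m \<rho>)"
proof -
  have "inv (transpose (\<rho> i) (\<rho> (i + 1)) \<circ> \<rho>) = transpose i (i + 1) \<circ> inv \<rho>"
    unfolding transpose_values_eq[OF \<rho>]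
    using o_inv_distrib[OF permutes_bij[OF \<rho>] bij_transpose] by simp
  then have inv: "inv (transpose (\<rho> i) (\<rho> (i + 1)) \<circ> \<rho>) v = transpose i (i + 1) (inv \<rho> v)" for v
    by simp
  note permutes_adjacent_in[OF \<rho> i(1)]
  moreover have "transpose i (i + 1) (inv \<rho> v) < transpose i (i + 1) (inv \<rho> u) \<longleftrightarrow>
      inv \<rho> v < inv \<rho> u \<or> (u = \<rho> i \<and> v = \<rho> (i + 1))" if "u < v" for u v
  proof -
    have uv: "\<rho> (inv \<rho> u) = u" "\<rho> (inv \<rho> v) = v" using permutes_inverses(1)[OF \<rho>] by auto
    then have "inv \<rho> u \<noteq> inv \<rho> v" "\<not> (inv \<rho> v = i \<and> inv \<rho> u = i + 1)"
      using that i(2) by (metis less_irrefl, metis less_asym)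
    moreover have "u = \<rho> i \<longleftrightarrow> inv \<rho> u = i" "v = \<rho> (i + 1) \<longleftrightarrow> inv \<rho> v = i + 1"
      using uv permutes_inverses(2)[OF \<rho>] by metis+
    ultimately show ?thesis by (auto simp: transpose_def)
  qed
  ultimately show ?thesis using i(2) unfolding inversions_def inv by auto
qed

lemma increasing_permutes_imp_id:
  fixes \<tau> :: "nat \<Rightarrow> nat"
  assumes "\<tau> permutes {1..m}" "\<And>i. i \<in> {1..<m} \<Longrightarrow> \<tau> i < \<tau> (i + 1)"
  shows "\<tau> = id"
proof (rule permutes_natset_ge[OF assms(1)])
  have "i \<in> {1..m} \<Longrightarrow> i \<le> \<tau> i" for i
  proof (induction i)
    case (Suc i)
    show ?case
    proof (cases "i = 0")
      case True
      then show ?thesis using permutes_in_image[OF assms(1), of "Suc i"] Suc.prems by auto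
    next
      case False
      then show ?thesis using Suc assms(2)[of i] by auto
    qed
  qed simp
  then show "\<forall>i\<in>{1..m}. i \<le> \<tau> i" by blast
qed

text \<open>
  If no step from \<open>\<rho>\<close> stayed below \<open>\<sigma>\<close>, then \<open>\<sigma>\<close> would take the values at any two adjacent
  positions of \<open>\<rho>\<close> in the order in which \<open>\<rho>\<close> takes them, and \<open>inv \<sigma> \<circ> \<rho>\<close> would be increasing.
\<close>

lemma ex_weak_bruhat_step:
  assumes \<rho>: "\<rho> permutes {1..m}" and \<sigma>: "\<sigma> permutes {1..m}"
    and sub: "inversions m \<rho> \<subseteq> inversions m \<sigma>" and "\<rho> \<noteq> \<sigma>"
  shows "\<exists>\<rho>'. weak_bruhat_step m \<rho> \<rho>' \<and> inversions m \<rho> \<subset> inversions m \<rho>' \<and>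
           inversions m \<rho>' \<subseteq> inversions m \<sigma>"
proof -
  have "\<exists>i\<in>{1..<m}. \<rho> i < \<rho> (i + 1) \<and> (\<rho> i, \<rho> (i + 1)) \<in> inversions m \<sigma>"
  proof (rule ccontr)
    assume no: "\<not> ?thesis"
    have "inv \<sigma> \<circ> \<rho> = id"
    proof (rule increasing_permutes_imp_id)
      show "inv \<sigma> \<circ> \<rho> permutes {1..m}" using \<rho> \<sigma> by (auto intro: permutes_compose permutes_inv)
      fix i assume i: "i \<in> {1..<m}"
      note mem = permutes_adjacent_in[OF \<rho> i]
      have "\<rho> i \<noteq> \<rho> (i + 1)" using permutes_inj[OF \<rho>] by (simp add: inj_eq)
      moreover from this have "inv \<sigma> (\<rho> i) \<noteq> inv \<sigma> (\<rho> (i + 1))"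
        using permutes_inj[OF permutes_inv[OF \<sigma>]] by (simp add: inj_eq)
      moreover have "(\<rho> (i + 1), \<rho> i) \<in> inversions m \<sigma>" if "\<rho> (i + 1) < \<rho> i"
        using that mem permutes_inverses(2)[OF \<rho>] by (intro subsetD[OF sub]) (auto simp: inversions_def)
      ultimately have "inv \<sigma> (\<rho> i) < inv \<sigma> (\<rho> (i + 1))"
        using no i mem by (cases "\<rho> i < \<rho> (i + 1)") (auto simp: inversions_def)
      then show "(inv \<sigma> \<circ> \<rho>) i < (inv \<sigma> \<circ> \<rho>) (i + 1)" by simp
    qed
    then have "\<sigma> (inv \<sigma> (\<rho> i)) = \<sigma> i" for i by (metis comp_apply id_apply)
    then have "\<rho> = \<sigma>" using permutes_inverses(1)[OF \<sigma>] by auto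
    then show False using assms(4) by simp
  qed
  then obtain i where i: "i \<in> {1..<m}" "\<rho> i < \<rho> (i + 1)" "(\<rho> i, \<rho> (i + 1)) \<in> inversions m \<sigma>"
    by blast
  have "(\<rho> i, \<rho> (i + 1)) \<notin> inversions m \<rho>"
    using permutes_inverses(2)[OF \<rho>] by (auto simp: inversions_def)
  then have "inversions m \<rho> \<subset> inversions m (transpose (\<rho> i) (\<rho> (i + 1)) \<circ> \<rho>)"
    unfolding inversions_step[OF \<rho> i(1,2)] by blast
  moreover have "inversions m (transpose (\<rho> i) (\<rho> (i + 1)) \<circ> \<rho>) \<subseteq> inversions m \<sigma>"
    unfolding inversions_step[OF \<rho> i(1,2)] using i(3) sub by blast
  moreover have "weak_bruhat_step m \<rho> (transpose (\<rho> i) (\<rho> (i + 1)) \<circ> \<rho>)"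
    using i(1,2) by (auto simp: weak_bruhat_step_def)
  ultimately show ?thesis by blast
qed

lemma inversions_eq_imp_eq:
  assumes "\<rho> permutes {1..m}" "\<sigma> permutes {1..m}" "inversions m \<rho> = inversions m \<sigma>"
  shows "\<rho> = \<sigma>"
  using ex_weak_bruhat_step[OF assms(1,2)] assms(3) by blast

text \<open>
  Every step provided by \<open>ex_weak_bruhat_step\<close> gains an inversion of \<open>\<sigma>\<close>, and there are only
  finitely many.
\<close>

lemma inversions_subset_imp_weak_bruhat:
  assumes "\<rho> permutes {1..m}" "\<sigma> permutes {1..m}" "inversions m \<rho> \<subseteq> inversions m \<sigma>"
  shows "(weak_bruhat_step m)\<^sup>*\<^sup>* \<rho> \<sigma>"
  using assms(1,3)
proof (induction "card (inversions m \<sigma> - inversions m \<rho>)" arbitrary: \<rho> rule: less_induct)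
  case less
  have fin: "finite (inversions m \<sigma>)"
    by (rule finite_subset[of _ "{1..m} \<times> {1..m}"]) (auto simp: inversions_def)
  show ?case
  proof (cases "\<rho> = \<sigma>")
    case False
    then obtain \<rho>' where \<rho>': "weak_bruhat_step m \<rho> \<rho>'" "inversions m \<rho> \<subset> inversions m \<rho>'"
      "inversions m \<rho>' \<subseteq> inversions m \<sigma>"
      using ex_weak_bruhat_step[OF less.prems(1) assms(2) less.prems(2)] by blast
    have "card (inversions m \<sigma> - inversions m \<rho>') < card (inversions m \<sigma> - inversions m \<rho>)"
      using \<rho>'(2,3) fin by (intro psubset_card_mono) auto
    then have "(weak_bruhat_step m)\<^sup>*\<^sup>* \<rho>' \<sigma>"
      using less.hyps \<rho>'(3) weak_bruhat_step_permutes[OF \<rho>'(1) less.prems(1)] by blast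
    then show ?thesis by (rule converse_rtranclp_into_rtranclp[of "weak_bruhat_step m", OF \<rho>'(1)])
  qed simp
qed


section \<open>Paths of the cube and permutations\<close>

text \<open>
  The order in which the path of a permutation turns the coordinates listed in \<open>ds\<close>: the values of
  the permutation, from the last to the first, are positions in \<open>ds\<close> counted from \<open>1\<close>.
\<close>

definition perm_order :: "nat list \<Rightarrow> (nat \<Rightarrow> nat) \<Rightarrow> nat list" where
  "perm_order ds \<rho> = rev (map (\<lambda>p. ds ! (\<rho> p - 1)) [1..<length ds + 1])"

lemma length_perm_order [simp]: "length (perm_order ds \<rho>) = length ds"
  by (simp add: perm_order_def del: upt_Suc)

lemma nth_perm_order:
  assumes "i < length ds"
  shows "perm_order ds \<rho> ! i = ds ! (\<rho> (length ds - i) - 1)"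
proof -
  have "[1..<length ds + 1] ! (length ds - Suc i) = length ds - i"
    using assms by (subst nth_upt) auto
  moreover have "perm_order ds \<rho> ! i = ds ! (\<rho> ([1..<length ds + 1] ! (length ds - Suc i)) - 1)"
    using assms by (simp add: perm_order_def rev_nth del: upt_Suc nth_upt)
  ultimately show ?thesis by simp
qed

lemma set_perm_order_image: "set (perm_order ds \<rho>) = (\<lambda>p. ds ! (\<rho> p - 1)) ` {1..length ds}"
proof -
  have "{1..<length ds + 1} = {1..length ds}" by auto
  then show ?thesis unfolding perm_order_def set_rev set_map set_upt by simp
qed

lemma distinct_perm_order:
  assumes "distinct ds" "\<rho> permutes {1..length ds}"
  shows "distinct (perm_order ds \<rho>)"
proof -
  have "p = q" if "p \<in> {1..length ds}" "q \<in> {1..length ds}" "ds ! (\<rho> p - 1) = ds ! (\<rho> q - 1)" for p q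
  proof -
    have "\<rho> p \<in> {1..length ds}" "\<rho> q \<in> {1..length ds}"
      using that(1,2) by (simp_all only: permutes_in_image[OF assms(2)])
    then have "\<rho> p = \<rho> q" using that(3) assms(1) by (auto simp: nth_eq_iff_index_eq)
    then show ?thesis using permutes_inj[OF assms(2)] by (simp add: inj_eq)
  qed
  then show ?thesis
    unfolding perm_order_def distinct_rev by (auto simp: distinct_map inj_on_def simp del: upt_Suc)
qed

lemma set_perm_order:
  assumes "distinct ds" "\<rho> permutes {1..length ds}"
  shows "set (perm_order ds \<rho>) = set ds"
proof (rule card_subset_eq)
  show "set (perm_order ds \<rho>) \<subseteq> set ds"
  proof
    fix k assume "k \<in> set (perm_order ds \<rho>)"
    then obtain p where p: "p \<in> {1..length ds}" "k = ds ! (\<rho> p - 1)"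
      unfolding set_perm_order_image by blast
    have "\<rho> p \<in> {1..length ds}" using p(1) by (simp only: permutes_in_image[OF assms(2)])
    then show "k \<in> set ds" using p(2) by auto
  qed
  show "card (set (perm_order ds \<rho>)) = card (set ds)"
    using assms distinct_perm_order[OF assms] by (simp add: distinct_card)
qed simp

lemma ex_perm_order:
  assumes "distinct ds" "distinct ks" "set ks = set ds"
  shows "\<exists>\<rho>. \<rho> permutes {1..length ds} \<and> perm_order ds \<rho> = ks"
proof -
  let ?m = "length ds"
  have len: "length ks = ?m" using assms by (metis distinct_card)
  have "\<forall>p. \<exists>i. p \<in> {1..?m} \<longrightarrow> i < ?m \<and> ds ! i = ks ! (?m - p)"
  proof
    fix p
    show "\<exists>i. p \<in> {1..?m} \<longrightarrow> i < ?m \<and> ds ! i = ks ! (?m - p)"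
    proof (cases "p \<in> {1..?m}")
      case True
      then have "ks ! (?m - p) \<in> set ds"
        unfolding assms(3)[symmetric] using len by (intro nth_mem) auto
      then show ?thesis by (auto simp: in_set_conv_nth)
    qed auto
  qed
  then obtain idx where idx: "\<And>p. p \<in> {1..?m} \<Longrightarrow> idx p < ?m \<and> ds ! idx p = ks ! (?m - p)"
    by metis
  \<comment> \<open>the value at \<open>p\<close> is the place in \<open>ds\<close>, counted from \<open>1\<close>, of the \<open>p\<close>-th last entry of \<open>ks\<close>\<close>
  define \<rho> where "\<rho> p = (if p \<in> {1..?m} then Suc (idx p) else p)" for p
  have "inj_on \<rho> {1..?m}"
  proof (rule inj_onI)
    fix p q assume pq: "p \<in> {1..?m}" "q \<in> {1..?m}" "\<rho> p = \<rho> q"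
    then have "ks ! (?m - p) = ks ! (?m - q)" using idx[of p] idx[of q] by (auto simp: \<rho>_def)
    moreover have "?m - p < length ks" "?m - q < length ks" using pq len by auto
    ultimately have "?m - p = ?m - q" using assms(2) by (simp add: nth_eq_iff_index_eq)
    then show "p = q" using pq by auto
  qed
  moreover have "\<rho> ` {1..?m} \<subseteq> {1..?m}" using idx by (fastforce simp: \<rho>_def)
  ultimately have "bij_betw \<rho> {1..?m} {1..?m}"
    by (simp add: bij_betw_def endo_inj_surj)
  then have "\<rho> permutes {1..?m}" by (rule bij_imp_permutes) (auto simp: \<rho>_def)
  moreover have "perm_order ds \<rho> = ks"
  proof (rule nth_equalityI)
    fix i assume "i < length (perm_order ds \<rho>)"
    then have "i < ?m" "?m - i \<in> {1..?m}" by auto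
    then show "perm_order ds \<rho> ! i = ks ! i"
      using idx[of "?m - i"] by (simp add: nth_perm_order \<rho>_def)
  qed (simp add: len)
  ultimately show ?thesis by blast
qed

text \<open>
  As the values are listed from the last to the first, an inversion \<open>u < v\<close> is a pair of
  coordinates of which the smaller one is turned first.
\<close>

lemma before_in_perm_order_iff:
  assumes ds: "distinct ds" and \<rho>: "\<rho> permutes {1..length ds}"
    and uv: "u \<in> {1..length ds}" "v \<in> {1..length ds}"
  shows "ds ! (u - 1) \<in> set (takeWhile (\<lambda>k. k \<noteq> ds ! (v - 1)) (perm_order ds \<rho>)) \<longleftrightarrow> inv \<rho> v < inv \<rho> u"
proof -
  let ?m = "length ds" and ?ks = "perm_order ds \<rho>"
  have pos: "inv \<rho> w \<in> {1..?m} \<and> ?ks ! (?m - inv \<rho> w) = ds ! (w - 1)" if "w \<in> {1..?m}" for w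
  proof -
    have "inv \<rho> w \<in> {1..?m}" using that by (simp only: permutes_in_image[OF permutes_inv[OF \<rho>]])
    moreover from this have "?m - inv \<rho> w < ?m" by auto
    ultimately show ?thesis using permutes_inverses(1)[OF \<rho>] by (simp add: nth_perm_order)
  qed
  let ?i = "?m - inv \<rho> u" and ?j = "?m - inv \<rho> v"
  have ij: "?i < length ?ks" "?j < length ?ks" using pos[OF uv(1)] pos[OF uv(2)] by auto
  have dist: "distinct ?ks" by (rule distinct_perm_order[OF ds \<rho>])
  have "takeWhile (\<lambda>k. k \<noteq> ?ks ! ?j) ?ks = take ?j ?ks"
    using ij dist by (intro takeWhile_eq_take_P_nth) (auto simp: nth_eq_iff_index_eq)
  moreover have "?ks ! ?i \<in> set (take ?j ?ks) \<longleftrightarrow> ?i < ?j"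
    using ij dist by (auto simp: in_set_conv_nth nth_eq_iff_index_eq)
  moreover have "?i < ?j \<longleftrightarrow> inv \<rho> v < inv \<rho> u" using pos[OF uv(1)] pos[OF uv(2)] by auto
  ultimately show ?thesis using pos[OF uv(1)] pos[OF uv(2)] by simp
qed

text \<open>
  A step exchanges two adjacent turns.  Before the step the larger of the two coordinates is turned
  first, which makes the old path the source and the new one the target of a square.
\<close>

lemma bounds_le_weak_bruhat_step:
  assumes ds: "sorted ds" "distinct ds" "set ds \<subseteq> {..<length \<delta>}" "\<forall>k\<in>set ds. \<not> \<delta> ! k"
    and \<rho>: "\<rho> permutes {1..length ds}" and step: "weak_bruhat_step (length ds) \<rho> \<sigma>"
  shows "bounds_le (adc_power arrow_adc (length \<delta>))
           (cube_chain \<delta> (perm_order ds \<rho>)) (cube_chain \<delta> (perm_order ds \<sigma>))"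
proof -
  let ?m = "length ds"
  obtain i where i: "i \<in> {1..<?m}" "\<rho> i < \<rho> (i + 1)"
    and \<sigma>: "\<sigma> = transpose (\<rho> i) (\<rho> (i + 1)) \<circ> \<rho>"
    using step by (auto simp: weak_bruhat_step_def)
  then have \<sigma>_eq: "\<sigma> = \<rho> \<circ> transpose i (i + 1)" using transpose_values_eq[OF \<rho>] by simp
  define k l where "k = ds ! (\<rho> i - 1)" and "l = ds ! (\<rho> (i + 1) - 1)"
  define ks ls where "ks = rev (map (\<lambda>p. ds ! (\<rho> p - 1)) [i + 2..<?m + 1])"
    and "ls = rev (map (\<lambda>p. ds ! (\<rho> p - 1)) [1..<i])"
  have "[1..<?m + 1] = [1..<i] @ [i..<?m + 1]" "[i..<?m + 1] = [i, i + 1] @ [i + 2..<?m + 1]"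
    using i(1) upt_add_eq_append[of 1 i "?m + 1 - i"] by (simp_all add: upt_conv_Cons del: upt_Suc)
  then have split: "[1..<?m + 1] = [1..<i] @ [i, i + 1] @ [i + 2..<?m + 1]" by metis
  have \<rho>_order: "perm_order ds \<rho> = ks @ l # k # ls"
    unfolding perm_order_def split by (simp add: ks_def ls_def k_def l_def)
  have "map (\<lambda>p. ds ! (\<sigma> p - 1)) [i + 2..<?m + 1] = map (\<lambda>p. ds ! (\<rho> p - 1)) [i + 2..<?m + 1]"
    "map (\<lambda>p. ds ! (\<sigma> p - 1)) [1..<i] = map (\<lambda>p. ds ! (\<rho> p - 1)) [1..<i]"
    by (auto simp: \<sigma>_eq transpose_def simp del: upt_Suc)
  then have \<sigma>_order: "perm_order ds \<sigma> = ks @ k # l # ls"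
    unfolding perm_order_def split by (simp add: ks_def ls_def k_def l_def \<sigma>_eq)
  from permutes_adjacent_in[OF \<rho> i(1)]
  have "\<rho> i - 1 < \<rho> (i + 1) - 1" "\<rho> (i + 1) - 1 < ?m" using i(2) by auto
  moreover have "sorted_wrt (<) ds" using ds(1,2) by (simp add: strict_sorted_iff)
  ultimately have "k < l" by (simp add: k_def l_def sorted_wrt_nth_less)
  have dist: "distinct (ks @ l # k # ls)" and set: "set (ks @ l # k # ls) = set ds"
    using distinct_perm_order[OF ds(2) \<rho>] set_perm_order[OF ds(2) \<rho>] \<rho>_order by simp_all
  have "distinct (ks @ k # l # ls)" using dist by auto
  moreover have "k \<in> set ds" "l \<in> set ds" "set ks \<subseteq> set ds" using set by auto
  ultimately show ?thesis
    unfolding \<rho>_order \<sigma>_order using \<open>k < l\<close> ds(3,4) by (intro bounds_le_swap) auto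
qed

text \<open>
  Weak Bruhat steps are squares and therefore give positive 2-chains.  Along a positive 2-chain the
  functionals \<^const>\<open>turned_before\<close> do not decrease, so inversions persist, and containment of
  inversion sets leads back to the weak Bruhat order.
\<close>

lemma bounds_le_perm_order_iff:
  assumes ds: "sorted ds" "distinct ds" "set ds \<subseteq> {..<length \<delta>}" "\<forall>k\<in>set ds. \<not> \<delta> ! k"
    and \<rho>: "\<rho> permutes {1..length ds}" and \<sigma>: "\<sigma> permutes {1..length ds}"
  shows "bounds_le (adc_power arrow_adc (length \<delta>))
           (cube_chain \<delta> (perm_order ds \<rho>)) (cube_chain \<delta> (perm_order ds \<sigma>))
         \<longleftrightarrow> (weak_bruhat_step (length ds))\<^sup>*\<^sup>* \<rho> \<sigma>"
    (is "?le \<rho> \<sigma> \<longleftrightarrow> _")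
proof
  let ?m = "length ds"
  assume le: "?le \<rho> \<sigma>"
  have pairing: "pairing (turned_before (ds ! (u - 1)) (ds ! (v - 1))) (cube_chain \<delta> (perm_order ds \<tau>)) =
      of_bool (inv \<tau> v < inv \<tau> u)"
    if "\<tau> permutes {1..?m}" "u \<in> {1..?m}" "v \<in> {1..?m}" "u \<noteq> v" for \<tau> u v
  proof -
    have "u - 1 < ?m" "v - 1 < ?m" "u - 1 \<noteq> v - 1" using that by auto
    then have "ds ! (u - 1) \<in> set ds" "ds ! (v - 1) \<in> set ds" "ds ! (u - 1) \<noteq> ds ! (v - 1)"
      using ds(2) by (auto simp: nth_eq_iff_index_eq)
    then show ?thesis
      using ds(3,4) distinct_perm_order[OF ds(2) that(1)] set_perm_order[OF ds(2) that(1)]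
        before_in_perm_order_iff[OF ds(2) that(1-3)]
      by (subst pairing_turned_before) auto
  qed
  have "inversions ?m \<rho> \<subseteq> inversions ?m \<sigma>"
  proof (rule subrelI)
    fix u v assume "(u, v) \<in> inversions ?m \<rho>"
    then have uv: "u < v" "inv \<rho> v < inv \<rho> u" and mem: "u \<in> {1..?m}" "v \<in> {1..?m}" "u \<noteq> v"
      by (auto simp: inversions_def)
    then have less: "ds ! (u - 1) < ds ! (v - 1)"
      using ds(1,2) sorted_wrt_nth_less[of "(<)" ds] by (simp add: strict_sorted_iff)
    have "ds ! (v - 1) \<in> set ds" using mem by (intro nth_mem) auto
    then have len: "ds ! (v - 1) < length \<delta>" using ds(3) by auto
    let ?\<phi> = "turned_before (ds ! (u - 1)) (ds ! (v - 1))"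
    have "pairing ?\<phi> (cube_chain \<delta> (perm_order ds \<rho>)) \<le> pairing ?\<phi> (cube_chain \<delta> (perm_order ds \<sigma>))"
      by (rule bounds_le_pairing_mono[OF le turned_before_square_nonneg[OF less len]])
    then have "inv \<sigma> v < inv \<sigma> u"
      using uv(2) unfolding pairing[OF \<rho> mem] pairing[OF \<sigma> mem] by (simp add: of_bool_def split: if_splits)
    then show "(u, v) \<in> inversions ?m \<sigma>" using uv(1) mem by (simp add: inversions_def)
  qed
  then show "(weak_bruhat_step ?m)\<^sup>*\<^sup>* \<rho> \<sigma>" by (rule inversions_subset_imp_weak_bruhat[OF \<rho> \<sigma>])
next
  assume "(weak_bruhat_step (length ds))\<^sup>*\<^sup>* \<rho> \<sigma>"
  then have "?le \<rho> \<sigma> \<and> \<sigma> permutes {1..length ds}"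
  proof (induction rule: rtranclp_induct)
    case (step \<tau> \<sigma>)
    then show ?case
      using bounds_le_weak_bruhat_step[OF ds _ step.hyps(2)] weak_bruhat_step_permutes bounds_le_trans
      by blast
  qed (use \<rho> in simp)
  then show "?le \<rho> \<sigma>" ..
qed

lemma weak_bruhat_step_inversions:
  assumes "\<rho> permutes {1..m}" "weak_bruhat_step m \<rho> \<sigma>"
  shows "inversions m \<rho> \<subseteq> inversions m \<sigma>"
  using assms inversions_step[OF assms(1)] by (auto simp: weak_bruhat_step_def)

lemma antisym_perm_poset: "antisym (perm_poset (Some m))"
proof (rule antisymI)
  have mono: "inversions m \<rho> \<subseteq> inversions m \<sigma> \<and> \<sigma> permutes {1..m}"
    if "(weak_bruhat_step m)\<^sup>*\<^sup>* \<rho> \<sigma>" "\<rho> permutes {1..m}" for \<rho> \<sigma>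
    using that
    by (induction rule: rtranclp_induct)
      (use weak_bruhat_step_inversions weak_bruhat_step_permutes in \<open>blast+\<close>)
  fix \<rho> \<sigma> assume "(\<rho>, \<sigma>) \<in> perm_poset (Some m)" "(\<sigma>, \<rho>) \<in> perm_poset (Some m)"
  then show "\<rho> = \<sigma>" using mono[of \<rho> \<sigma>] mono[of \<sigma> \<rho>] by (auto intro: inversions_eq_imp_eq)
qed

lemma displacement_eq:
  assumes "length \<epsilon> = length \<delta>"
  shows "displacement \<delta> \<epsilon> =
    (if list_all2 (\<le>) \<delta> \<epsilon> then Some (length (diff_coords \<delta> \<epsilon>)) else None)"
proof (cases "list_all2 (\<le>) \<delta> \<epsilon>")
  case True
  then have le: "\<delta> ! k \<le> \<epsilon> ! k" if "k < length \<delta>" for k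
    using that by (simp add: list_all2_conv_all_nth)
  then have "\<not> (\<exists>k<length \<delta>. \<delta> ! k > \<epsilon> ! k)" using leD by blast
  moreover have "(\<Sum>k<length \<delta>. of_bool (\<epsilon> ! k) - of_bool (\<delta> ! k)) =
      (\<Sum>k<length \<delta>. of_bool (\<delta> ! k \<noteq> \<epsilon> ! k) :: nat)"
    using le by (intro sum.cong) (auto simp: le_bool_def)
  moreover have "\<dots> = card {k. k < length \<delta> \<and> \<delta> ! k \<noteq> \<epsilon> ! k}"
    by (simp add: Int_def)
  moreover have "\<dots> = card (set (diff_coords \<delta> \<epsilon>))"
    by (rule arg_cong[of _ _ card]) (auto simp: diff_coords_def)
  moreover have "\<dots> = length (diff_coords \<delta> \<epsilon>)"
    by (rule distinct_card) (simp add: diff_coords_def)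
  ultimately show ?thesis using True by (simp add: displacement_def)
next
  case False
  then show ?thesis
    using assms by (auto simp: displacement_def list_all2_conv_all_nth not_le)
qed

theorem pi1_cube:
  assumes "\<delta> \<in> bool_power n" "\<epsilon> \<in> bool_power n"
  shows "poset_iso (perm_poset (displacement \<delta> \<epsilon>))
         (pi1 (oriented_cube n) (cube_vertex \<delta>) (cube_vertex \<epsilon>))
         (\<lambda>\<rho>. pi1_class (oriented_cube n) (cube_vertex \<delta>) (cube_vertex \<epsilon>) (cube_path n \<delta> \<epsilon> \<rho>))"
proof (cases "list_all2 (\<le>) \<delta> \<epsilon>")
  case False
  have len: "length \<delta> = n" "length \<epsilon> = n" using assms by (simp_all add: bool_power_def)
  have "cube.paths n (map Pt \<delta>) (map Pt \<epsilon>) = {}"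
    using False cube_paths_iff[OF len] by blast
  then show ?thesis
    unfolding oriented_cube_def cube_vertex_def displacement_eq[OF trans[OF len(2) len(1)[symmetric]]]
    using False assms
    by (intro cube.poset_iso_pi1I[where A = "{}"]) (auto simp: cube_vertices antisym_def)
next
  case True
  have len: "length \<delta> = n" "length \<epsilon> = n" using assms by (simp_all add: bool_power_def)
  define ds where "ds = diff_coords \<delta> \<epsilon>"
  let ?m = "length ds"
  have set_ds: "set ds = {k. k < length \<delta> \<and> \<delta> ! k \<noteq> \<epsilon> ! k}"
    by (auto simp: ds_def diff_coords_def)
  have ds: "sorted ds" "distinct ds" "set ds \<subseteq> {..<length \<delta>}"
    unfolding ds_def diff_coords_def by (auto intro: sorted_wrt_filter)
  have ds0: "\<forall>k\<in>set ds. \<not> \<delta> ! k"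
    using True by (auto simp: set_ds list_all2_conv_all_nth)
  have orders: "perm_order ds ` {\<rho>. \<rho> permutes {1..?m}} = flip_orders \<delta> \<epsilon>"
    using distinct_perm_order[OF ds(2)] set_perm_order[OF ds(2)] ex_perm_order[OF ds(2)]
    unfolding flip_orders_def set_ds[symmetric] by (auto simp: image_iff) metis
  have disp: "displacement \<delta> \<epsilon> = Some ?m"
    using displacement_eq[of \<epsilon> \<delta>] len True by (simp add: ds_def)
  show ?thesis
    unfolding oriented_cube_def cube_vertex_def disp
  proof (rule cube.poset_iso_pi1I[where A = "{\<rho>. \<rho> permutes {1..?m}}"
        and f = "\<lambda>\<rho>. cube_chain \<delta> (perm_order ds \<rho>)"])
    show "map Pt \<delta> \<in> cube.vertices n" "map Pt \<epsilon> \<in> cube.vertices n"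
      using assms by (auto simp: cube_vertices)
    show "antisym (perm_poset (Some ?m))" by (rule antisym_perm_poset)
    show "(\<lambda>\<rho>. cube_chain \<delta> (perm_order ds \<rho>)) ` {\<rho>. \<rho> permutes {1..?m}} =
        cube.paths n (map Pt \<delta>) (map Pt \<epsilon>)"
      using cube_paths_iff[OF len] True unfolding orders[symmetric] by auto
    show "(\<rho>, \<sigma>) \<in> perm_poset (Some ?m) \<longleftrightarrow> bounds_le (adc_power arrow_adc n)
        (cube_chain \<delta> (perm_order ds \<rho>)) (cube_chain \<delta> (perm_order ds \<sigma>))"
      if "\<rho> \<in> {\<rho>. \<rho> permutes {1..?m}}" "\<sigma> \<in> {\<rho>. \<rho> permutes {1..?m}}" for \<rho> \<sigma>
      using that bounds_le_perm_order_iff[OF ds ds0, of \<rho> \<sigma>] len by simp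
    show "cube_path n \<delta> \<epsilon> \<rho> = path_table (map Pt \<delta>) (map Pt \<epsilon>) (cube_chain \<delta> (perm_order ds \<rho>))"
      if "\<rho> \<in> {\<rho>. \<rho> permutes {1..?m}}" for \<rho>
    proof -
      let ?ks = "perm_order ds \<rho>"
      have ks: "?ks \<in> flip_orders \<delta> \<epsilon>" using that orders by blast
      then have "set ?ks \<subseteq> {..<length \<delta>}" by (auto simp: flip_orders_def)
      have "cube_path n \<delta> \<epsilon> \<rho> = path_comp (nu (adc_power arrow_adc n)) (\<lambda>\<delta>. nu_obj (map Pt \<delta>))
          (\<lambda>\<delta> \<epsilon>. nu_arr (map Pt \<delta>) (map Pt \<epsilon>) (map2 (\<lambda>a b. if a = b then Pt a else Arr) \<delta> \<epsilon>))
          (flip_path \<delta> ?ks)"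
        unfolding cube_path_def oriented_cube_def cube_vertex_def[abs_def] cube_edge_def[abs_def]
          perm_order_def ds_def Let_def ..
      also have "\<dots> = path_table (map Pt \<delta>) (map Pt \<epsilon>) (cube_chain \<delta> ?ks)"
        unfolding path_comp_eq_path_table[OF flip_path_ends(1)] flip_path_ends(2,3)
          path_chain_flip_path[OF \<open>set ?ks \<subseteq> _\<close>] fold_flip_at_orders[OF ks trans[OF len(2) len(1)[symmetric]]] ..
      finally show ?thesis .
    qed
  qed auto
qed

theorem corollary1p10p13:
  fixes n :: nat
  shows
    "poset_iso (chain_poset n) (pi0 (oriental n))
       (\<lambda>i. pi0_class (oriental n) (simplex_vertex i))
     \<and>
     (\<forall>i j. i < j \<and> j \<le> n \<longrightarrow>
       poset_iso (bool_power_poset (j - i - 1)) (subset_poset {i + 1..j - 1})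
         (\<lambda>\<delta>. {k \<in> {i + 1..j - 1}. \<delta> ! (k - (i + 1))}) \<and>
       poset_iso (subset_poset {i + 1..j - 1})
         (pi1 (oriental n) (simplex_vertex i) (simplex_vertex j))
         (\<lambda>A. pi1_class (oriental n) (simplex_vertex i) (simplex_vertex j) (simplex_path n i j A)))
     \<and>
     poset_iso (bool_power_poset n) (pi0 (oriented_cube n))
       (\<lambda>\<delta>. pi0_class (oriented_cube n) (cube_vertex \<delta>))
     \<and>
     (\<forall>\<delta>\<in>bool_power n. \<forall>\<epsilon>\<in>bool_power n.
       poset_iso (perm_poset (displacement \<delta> \<epsilon>))
         (pi1 (oriented_cube n) (cube_vertex \<delta>) (cube_vertex \<epsilon>))
         (\<lambda>\<rho>. pi1_class (oriented_cube n) (cube_vertex \<delta>) (cube_vertex \<epsilon>) (cube_path n \<delta> \<epsilon> \<rho>)))"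
  using pi0_oriental pi1_oriental bool_power_poset_iso_subset_poset pi0_cube pi1_cube by blast

end
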